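(* Deadlock detection in broadcast protocols is undecidable: there is no algorithm that, given a broadcast process template $B$, decides whether its broadcast counter system $M^{BC}$ has a deadlocked run (a finite maximal path starting in an initial state).
   Context: A broadcast process template is $B=(Q_B,\mathit{init}_B,\Sigma,\delta_B)$ with finite state set $Q_B=\{q_0,\dots,q_{|B|-1}\}$, initial state $\mathit{init}_B$, alphabet $\Sigma=(\Sigma_{sync}\times\{!!,??\})\cup\{\tau\}$ for a finite set $\Sigma_{sync}$ of synchronizing actions ($a!!$ = send broadcast $a$, $a??$ = receive broadcast $a$, $\tau$ = internal), and $\delta_B\subseteq Q_B\times\Sigma\times Q_B$, such that for every $a\in\Sigma_{sync}$ and every $q\in Q_B$ there is exactly one $q'$ with $(q,a??,q')\in\delta_B$. For $a\in\Sigma_{sync}$ the broadcast matrix $M_a$ is the $|B|\times|B|$ 0/1 matrix with $M_a(j,i)=1$ iff $(q_i,a??,q_j)\in\delta_B$. The broadcast counter system $M^{BC}=(S,S_0,\Delta)$ has states $S=\mathbb N_0^{|B|}$ ($\vec c(i)$ = number of processes in $q_i$), initial states $S_0=\{\vec c\mid \vec c(q)=0 \text{ iff } q\ne\mathit{init}_B\}$, and $(\vec c,\vec c')\in\Delta$ iff either there is $(q_i,\tau,q_j)\in\delta_B$ with $\vec c(i)\ge1$ and $\vec c'=\vec c-\vec u_i+\vec u_j$, or there are $a\in\Sigma_{sync}$ and $(q_i,a!!,q_j)\in\delta_B$ with $\vec c(i)\ge1$ and $\vec c'=M_a(\vec c-\vec u_i)+\vec u_j$ (here $\vec u_i$ is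 the $i$-th unit vector). A path is a sequence of states related consecutively by $\Delta$; a run is a maximal (non-extendable) path starting in $S_0$; it is deadlocked if finite. *)

theory Defs
  imports "Jordan_Normal_Form.Matrix" "HOL-Library.Nat_Bijection"
begin

section \<open>Broadcast process templates\<close>

text \<open>State \<open>q\<^sub>i\<close> is represented by its index \<open>i\<close>; synchronizing actions are named by
  natural numbers, so that a template is a finite object that can be given to an algorithm.\<close>

datatype label = Tau | Send nat | Receive nat

record template =
  num_states :: nat
  init_state :: nat
  sync_actions :: "nat set"
  delta :: "(nat \<times> label \<times> nat) set"

definition states :: "template \<Rightarrow> nat set" where
  "states B = {..<num_states B}"

definition alphabet :: "template \<Rightarrow> label set" where
  "alphabet B = Send ` sync_actions B \<union> Receive ` sync_actions B \<union> {Tau}"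

definition broadcast_template :: "template \<Rightarrow> bool" where
  "broadcast_template B \<longleftrightarrow>
     init_state B \<in> states B \<and>
     finite (sync_actions B) \<and>
     delta B \<subseteq> states B \<times> alphabet B \<times> states B \<and>
     (\<forall>a\<in>sync_actions B. \<forall>q\<in>states B. \<exists>!q'. (q, Receive a, q') \<in> delta B)"


section \<open>Broadcast counter systems\<close>

definition broadcast_matrix :: "template \<Rightarrow> nat \<Rightarrow> nat mat" where
  "broadcast_matrix B a = mat (num_states B) (num_states B)
     (\<lambda>(j, i). if (i, Receive a, j) \<in> delta B then 1 else 0)"

definition bc_states :: "template \<Rightarrow> nat vec set" where
  "bc_states B = carrier_vec (num_states B)"

definition bc_initial :: "template \<Rightarrow> nat vec set" where
  "bc_initial B = {c \<in> bc_states B. \<forall>q\<in>states B. c $ q = 0 \<longleftrightarrow> q \<noteq> init_state B}"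

text \<open>Subtraction of natural numbers is truncated, but every subtraction below is guarded by
  \<open>c $ i \<ge> 1\<close>.\<close>

definition bc_trans :: "template \<Rightarrow> (nat vec \<times> nat vec) set" where
  "bc_trans B = {(c, c'). c \<in> bc_states B \<and> c' \<in> bc_states B \<and>
     (let u = unit_vec (num_states B) in
       (\<exists>i j. (i, Tau, j) \<in> delta B \<and> c $ i \<ge> 1 \<and> c' = c - u i + u j) \<or>
       (\<exists>a\<in>sync_actions B. \<exists>i j. (i, Send a, j) \<in> delta B \<and> c $ i \<ge> 1 \<and>
          c' = broadcast_matrix B a *\<^sub>v (c - u i) + u j))}"

definition finite_path :: "template \<Rightarrow> nat vec list \<Rightarrow> bool" where
  "finite_path B cs \<longleftrightarrow>
     cs \<noteq> [] \<and> set cs \<subseteq> bc_states B \<and> successively (\<lambda>c c'. (c, c') \<in> bc_trans B) cs"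

text \<open>Infinite runs are never deadlocked, so only finite paths have to be considered here.\<close>

definition deadlocked_run :: "template \<Rightarrow> nat vec list \<Rightarrow> bool" where
  "deadlocked_run B cs \<longleftrightarrow>
     finite_path B cs \<and> hd cs \<in> bc_initial B \<and> (\<nexists>c'. finite_path B (cs @ [c']))"

definition has_deadlocked_run :: "template \<Rightarrow> bool" where
  "has_deadlocked_run B \<longleftrightarrow> (\<exists>cs. deadlocked_run B cs)"


section \<open>Algorithms\<close>

text \<open>Algorithms are modelled by partial recursive functions. \<open>rec_eval f xs y\<close> means
  that \<open>f\<close> terminates on the arguments \<open>xs\<close> with result \<open>y\<close>. Primitive recursion and
  minimization act on the first argument.\<close>

datatype recf =
    Zero
  | Succ
  | Proj nat
  | Comp recf "recf list"
  | PrimRec recf recf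
  | Mu recf

inductive rec_eval :: "recf \<Rightarrow> nat list \<Rightarrow> nat \<Rightarrow> bool" where
  Zero: "rec_eval Zero xs 0"
| Succ: "rec_eval Succ [x] (Suc x)"
| Proj: "i < length xs \<Longrightarrow> rec_eval (Proj i) xs (xs ! i)"
| Comp: "list_all2 (\<lambda>g y. rec_eval g xs y) gs ys \<Longrightarrow> rec_eval f ys z
    \<Longrightarrow> rec_eval (Comp f gs) xs z"
| PrimRec_0: "rec_eval f xs z \<Longrightarrow> rec_eval (PrimRec f g) (0 # xs) z"
| PrimRec_Suc: "rec_eval (PrimRec f g) (n # xs) y \<Longrightarrow> rec_eval g (n # y # xs) z
    \<Longrightarrow> rec_eval (PrimRec f g) (Suc n # xs) z"
| Mu: "rec_eval f (n # xs) 0 \<Longrightarrow> \<forall>m<n. \<exists>v. rec_eval f (m # xs) (Suc v)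
    \<Longrightarrow> rec_eval (Mu f) xs n"

lemma rec_eval_det: "rec_eval f xs y \<Longrightarrow> rec_eval f xs z \<Longrightarrow> y = z"
proof (induction arbitrary: z rule: rec_eval.induct)
  case (Comp xs gs ys f w)
  from Comp.prems obtain ys' where ys': "list_all2 (\<lambda>g y. rec_eval g xs y) gs ys'"
    "rec_eval f ys' z"
    by (auto elim: rec_eval.cases)
  have "ys = ys'"
    using Comp.IH(1) ys'(1) by (intro nth_equalityI) (auto simp: list_all2_conv_all_nth)
  then show ?case using Comp.IH(2) ys'(2) by blast
next
  case (PrimRec_0 f xs w g)
  from PrimRec_0.prems have "rec_eval f xs z" by (cases rule: rec_eval.cases) auto
  then show ?case by (rule PrimRec_0.IH)
next
  case (PrimRec_Suc f g n xs y w)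
  from PrimRec_Suc.prems obtain y' where "rec_eval (PrimRec f g) (n # xs) y'"
    "rec_eval g (n # y' # xs) z" by (cases rule: rec_eval.cases) auto
  then show ?case using PrimRec_Suc.IH by blast
next
  case (Mu f n xs)
  from Mu.prems have z: "rec_eval f (z # xs) 0" "\<forall>m<z. \<exists>v. rec_eval f (m # xs) (Suc v)"
    by (cases rule: rec_eval.cases; blast)+
  show ?case
  proof (cases n z rule: linorder_cases)
    case less
    then show ?thesis using z(2) Mu.IH(1) by blast
  next
    case greater
    then show ?thesis using z(1) Mu.IH(2) by blast
  qed
qed (auto elim: rec_eval.cases)

text \<open>Decidability of a property \<open>P\<close> of instances from \<open>A\<close> that are presented to the algorithm
  through the encoding \<open>enc\<close>. Nothing is required of the algorithm on other inputs.\<close>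

definition decidable_via :: "('a \<Rightarrow> nat) \<Rightarrow> 'a set \<Rightarrow> ('a \<Rightarrow> bool) \<Rightarrow> bool" where
  "decidable_via enc A P \<longleftrightarrow> (\<exists>f. \<forall>x\<in>A. rec_eval f [enc x] (if P x then 1 else 0))"


section \<open>Encoding of templates\<close>

fun label_code :: "label \<Rightarrow> nat" where
  "label_code Tau = 0"
| "label_code (Send a) = 2 * a + 1"
| "label_code (Receive a) = 2 * a + 2"

definition transition_code :: "nat \<times> label \<times> nat \<Rightarrow> nat" where
  "transition_code = (\<lambda>(p, l, q). prod_encode (p, prod_encode (label_code l, q)))"

text \<open>The finite sets are encoded by their bit masks.\<close>

definition template_code :: "template \<Rightarrow> nat" where
  "template_code B =
     prod_encode (num_states B,
       prod_encode (init_state B,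
         prod_encode (set_encode (sync_actions B),
           set_encode (transition_code ` delta B))))"

text \<open>The encoding loses no information, so a template is determined by the input of the
  algorithm.\<close>

lemma inj_label_code: "inj label_code"
proof (rule injI)
  fix k l assume "label_code k = label_code l"
  then show "k = l" by (cases k; cases l; simp; presburger)
qed

lemma inj_transition_code: "inj transition_code"
  using inj_label_code by (auto simp: inj_def transition_code_def)

lemma finite_delta: "broadcast_template B \<Longrightarrow> finite (delta B)"
  by (rule finite_subset[of _ "states B \<times> alphabet B \<times> states B"])
    (auto simp: broadcast_template_def states_def alphabet_def)

lemma inj_on_template_code: "inj_on template_code {B. broadcast_template B}"
proof (rule inj_onI)
  fix B C assume B: "B \<in> {B. broadcast_template B}" and C: "C \<in> {B. broadcast_template B}"
    and eq: "template_code B = template_code C"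
  have fin: "finite (sync_actions B)" "finite (sync_actions C)"
    using B C by (auto simp: broadcast_template_def)
  have fin': "finite (transition_code ` delta B)" "finite (transition_code ` delta C)"
    using B C finite_delta by auto
  have "transition_code ` delta B = transition_code ` delta C"
    using eq fin' by (simp add: template_code_def set_encode_eq)
  then have "delta B = delta C"
    using inj_transition_code by (simp add: inj_image_eq_iff)
  then show "B = C"
    using eq fin by (simp add: template_code_def set_encode_eq)
qed

end

theory Submission
  imports Defs
begin

text \<open>The halting problem is reduced to deadlock detection. A partial recursive function is
  turned into a nondeterministic counter program. The template simulates such a program with one
  control process; the value of a register is the number of processes in its state. A register is
  changed by a broadcast of the process that enters or leaves it, to which control reacts by changing
  its line, and zero is tested by a broadcast that sends a unit of the tested register to a trap with
  an internal loop, as does every broadcast that control does not expect. Hence every run that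
  deviates from the program is infinite. When the program halts, control broadcasts the halt
  action, which moves all processes to a dead state, so that a deadlock is reachable, given enough
  processes, iff the program halts.

  The input \<open>n\<close> is loaded by \<open>n\<close> additional lines of the program, so the code of the
  template is a total recursive function of \<open>n\<close> and four numbers that depend on the program
  alone. If \<open>f\<close> decided the existence of deadlocked runs, there would be a program which takes the
  code of a program \<open>P\<close> as input and halts iff \<open>f\<close> rejects the template of \<open>P\<close> run on
  its own code. Its own code would give a contradiction.\<close>

section \<open>Nondeterministic counter programs\<close>

type_synonym store = "nat \<Rightarrow> nat"

datatype operation = Inc nat | Dec nat | Test nat

datatype com = Op operation | Seq com com (infixr ";;" 60) | Star com

fun op_sem :: "operation \<Rightarrow> store \<Rightarrow> store \<Rightarrow> bool" where
  "op_sem (Inc r) s s' \<longleftrightarrow> s' = s(r := Suc (s r))"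
| "op_sem (Dec r) s s' \<longleftrightarrow> s r > 0 \<and> s' = s(r := s r - 1)"
| "op_sem (Test r) s s' \<longleftrightarrow> s r = 0 \<and> s' = s"

primrec sem :: "com \<Rightarrow> store \<Rightarrow> store \<Rightarrow> bool" where
  "sem (Op a) = op_sem a"
| "sem (Seq c d) = sem c OO sem d"
| "sem (Star c) = (sem c)\<^sup>*\<^sup>*"

text \<open>\<open>P i y\<close> is an invariant for \<open>i\<close> completed rounds with
  accumulator \<open>y\<close>. By \<open>step\<close>, the successors of any state of level
  \<open>i\<close> are all the states of level \<open>Suc i\<close>, so a path to a given state can
  be routed through whichever predecessor \<open>pred\<close> provides.\<close>

lemma rtranclp_indexed_iff:
  assumes "P 0 y0" and "\<And>y. P 0 y \<Longrightarrow> y = y0"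
    and step: "\<And>i y u. P i y \<Longrightarrow> R (S i y) u \<longleftrightarrow> (\<exists>y'. P (Suc i) y' \<and> u = S (Suc i) y')"
    and pred: "\<And>i y. P (Suc i) y \<Longrightarrow> \<exists>y'. P i y'"
  shows "R\<^sup>*\<^sup>* (S 0 y0) u \<longleftrightarrow> (\<exists>j y. P j y \<and> u = S j y)"
proof
  assume "R\<^sup>*\<^sup>* (S 0 y0) u"
  then show "\<exists>j y. P j y \<and> u = S j y"
    by (induction rule: rtranclp_induct) (use assms(1) step in blast)+
next
  have "R\<^sup>*\<^sup>* (S 0 y0) (S j y)" if "P j y" for j y
    using that
  proof (induction j arbitrary: y)
    case 0
    then show ?case using assms(2) by blast
  next
    case (Suc j)
    then obtain y' where y': "P j y'" using pred by blast
    then have "R (S j y') (S (Suc j) y)" using step Suc.prems by blast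
    then show ?case using Suc.IH[OF y'] by simp
  qed
  then show "\<exists>j y. P j y \<and> u = S j y \<Longrightarrow> R\<^sup>*\<^sup>* (S 0 y0) u" by blast
qed

lemma rtranclp_counted_iff:
  assumes "\<And>i u. R (S i) u \<longleftrightarrow> P i \<and> u = S (Suc i)"
  shows "R\<^sup>*\<^sup>* (S 0) u \<longleftrightarrow> (\<exists>j. (\<forall>m<j. P m) \<and> u = S j)"
  using rtranclp_indexed_iff[of "\<lambda>j _. \<forall>m<j. P m" "()" R "\<lambda>j _. S j" u] assms
  by (auto simp: less_Suc_eq)

text \<open>\<open>Star\<close> may stop after any number of rounds; the \<open>Test\<close> that
  follows discards the executions that stop before the register is drained. \<open>move\<close>,
  \<open>copy\<close> and \<open>cancel\<close> become deterministic in the same way.\<close>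

definition clear :: "nat \<Rightarrow> com" where
  "clear r = Star (Op (Dec r)) ;; Op (Test r)"

definition move :: "nat \<Rightarrow> nat \<Rightarrow> com" where
  "move r t = Star (Op (Dec r) ;; Op (Inc t)) ;; Op (Test r)"

text \<open>Reading a register destroys it, so a second copy is collected in \<open>w\<close> and
  moved back.\<close>

definition copy :: "nat \<Rightarrow> nat \<Rightarrow> nat \<Rightarrow> com" where
  "copy r t w = Star (Op (Dec r) ;; Op (Inc t) ;; Op (Inc w)) ;; Op (Test r) ;; move w r"

text \<open>An equality check: both registers are decremented in lockstep and have to reach zero
  together.\<close>

definition cancel :: "nat \<Rightarrow> nat \<Rightarrow> com" where
  "cancel r t = Star (Op (Dec r) ;; Op (Dec t)) ;; Op (Test r) ;; Op (Test t)"

definition guess :: "nat \<Rightarrow> com" where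
  "guess r = Star (Op (Inc r))"

lemma sem_Op [simp]: "sem (Op a) s s' \<longleftrightarrow> op_sem a s s'"
  by simp

lemma sem_Seq [simp]: "sem (c ;; d) s s' \<longleftrightarrow> (\<exists>u. sem c s u \<and> sem d u s')"
  by auto

declare sem.simps [simp del]

lemma sem_Star_indexed_iff:
  assumes "P 0 y0" and "\<And>y. P 0 y \<Longrightarrow> y = y0"
    and "\<And>i y u. P i y \<Longrightarrow> sem c (S i y) u \<longleftrightarrow> (\<exists>y'. P (Suc i) y' \<and> u = S (Suc i) y')"
    and "\<And>i y. P (Suc i) y \<Longrightarrow> \<exists>y'. P i y'"
  shows "sem (Star c) (S 0 y0) u \<longleftrightarrow> (\<exists>j y. P j y \<and> u = S j y)"
  unfolding sem.simps by (rule rtranclp_indexed_iff) (use assms in blast)+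

lemma sem_Star_counted_iff:
  assumes "\<And>i u. sem c (S i) u \<longleftrightarrow> P i \<and> u = S (Suc i)"
  shows "sem (Star c) (S 0) u \<longleftrightarrow> (\<exists>j. (\<forall>m<j. P m) \<and> u = S j)"
  unfolding sem.simps using assms by (rule rtranclp_counted_iff)

lemma sem_Star_bounded_iff:
  assumes "\<And>i u. sem c (S i) u \<longleftrightarrow> i < n \<and> u = S (Suc i)"
  shows "sem (Star c) (S 0) u \<longleftrightarrow> (\<exists>j\<le>n. u = S j)"
proof -
  have "(\<forall>m<j. m < n) \<longleftrightarrow> j \<le> n" for j
    by (meson leI less_irrefl less_le_trans)
  then show ?thesis using sem_Star_counted_iff[of c S "\<lambda>i. i < n", OF assms] by simp
qed

lemma sem_clear [simp]: "sem (clear r) s s' \<longleftrightarrow> s' = s(r := 0)"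
proof -
  have "sem (Star (Op (Dec r))) s u \<longleftrightarrow> (\<exists>j\<le>s r. u = s(r := s r - j))" for u
    using sem_Star_bounded_iff[of "Op (Dec r)" "\<lambda>i. s(r := s r - i)" "s r" u] by auto
  then show ?thesis
    by (auto simp: clear_def)
qed

lemma sem_move [simp]:
  assumes "r \<noteq> t"
  shows "sem (move r t) s s' \<longleftrightarrow> s' = s(r := 0, t := s t + s r)"
proof -
  let ?c = "Op (Dec r) ;; Op (Inc t)" and ?S = "\<lambda>i. s(r := s r - i, t := s t + i)"
  have "sem ?c (?S i) u \<longleftrightarrow> i < s r \<and> u = ?S (Suc i)" for i u
    using assms by (simp; auto simp: fun_eq_iff)
  then have "sem (Star ?c) (?S 0) u \<longleftrightarrow> (\<exists>j\<le>s r. u = ?S j)" for u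
    by (rule sem_Star_bounded_iff)
  then have "sem (Star ?c) s u \<longleftrightarrow> (\<exists>j\<le>s r. u = ?S j)" for u
    by simp
  then show ?thesis using assms
    by (auto simp: move_def)
qed

lemma sem_copy [simp]:
  assumes "r \<noteq> t" "r \<noteq> w" "t \<noteq> w" "s w = 0"
  shows "sem (copy r t w) s s' \<longleftrightarrow> s' = s(t := s t + s r)"
proof -
  let ?c = "Op (Dec r) ;; Op (Inc t) ;; Op (Inc w)"
  let ?S = "\<lambda>i. s(r := s r - i, t := s t + i, w := i)"
  have "sem ?c (?S i) u \<longleftrightarrow> i < s r \<and> u = ?S (Suc i)" for i u
    using assms by (simp; auto simp: fun_eq_iff)
  then have "sem (Star ?c) (?S 0) u \<longleftrightarrow> (\<exists>j\<le>s r. u = ?S j)" for u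
    by (rule sem_Star_bounded_iff)
  moreover have "?S 0 = s" using assms by (auto simp: fun_eq_iff)
  ultimately have drain: "sem (Star ?c ;; Op (Test r)) s u \<longleftrightarrow> u = ?S (s r)" for u
    using assms by auto
  have "sem (copy r t w) s s' \<longleftrightarrow>
      (\<exists>u. sem (Star ?c ;; Op (Test r)) s u \<and> sem (move w r) u s')"
    unfolding copy_def sem_Seq by blast
  then have "sem (copy r t w) s s' \<longleftrightarrow> sem (move w r) (?S (s r)) s'"
    by (simp only: drain) blast
  moreover have "(?S (s r))(w := 0, r := ?S (s r) r + ?S (s r) w) = s(t := s t + s r)"
    using assms by (auto simp: fun_eq_iff)
  ultimately show ?thesis using assms by simp
qed

lemma sem_cancel [simp]:
  assumes "r \<noteq> t"
  shows "sem (cancel r t) s s' \<longleftrightarrow> s r = s t \<and> s' = s(r := 0, t := 0)"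
proof -
  let ?c = "Op (Dec r) ;; Op (Dec t)" and ?S = "\<lambda>i. s(r := s r - i, t := s t - i)"
  have "sem ?c (?S i) u \<longleftrightarrow> i < min (s r) (s t) \<and> u = ?S (Suc i)" for i u
    using assms by (simp; auto simp: fun_eq_iff)
  then have "sem (Star ?c) (?S 0) u \<longleftrightarrow> (\<exists>j\<le>min (s r) (s t). u = ?S j)" for u
    by (rule sem_Star_bounded_iff)
  then have "sem (Star ?c) s u \<longleftrightarrow> (\<exists>j\<le>min (s r) (s t). u = ?S j)" for u
    by simp
  then show ?thesis using assms
    by (auto simp: cancel_def)
qed

lemma sem_guess [simp]: "sem (guess r) s s' \<longleftrightarrow> (\<exists>v. s' = s(r := s r + v))"
  using sem_Star_counted_iff[of "Op (Inc r)" "\<lambda>i. s(r := s r + i)" "\<lambda>_. True" s']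
  by (auto simp: guess_def)

lemma ex_clear_range: "\<exists>c. \<forall>s s'. sem c s s' \<longleftrightarrow> s' = (\<lambda>r. if d \<le> r \<and> r < d + n then 0 else s r)"
proof (induction n)
  case 0
  \<comment> \<open>A substitute for a skip command: the loop body can never be completed, as
    register 0 is positive when it is tested, so only zero rounds are possible.\<close>
  have "sem (Star (Op (Inc 0) ;; Op (Test 0))) s s' \<longleftrightarrow> s' = s" for s s'
    using sem_Star_bounded_iff[of "Op (Inc 0) ;; Op (Test 0)" "\<lambda>_. s" 0 s'] by auto
  then show ?case by (intro exI[of _ "Star (Op (Inc 0) ;; Op (Test 0))"]) auto
next
  case (Suc n)
  then obtain c where "\<And>s s'. sem c s s' \<longleftrightarrow> s' = (\<lambda>r. if d \<le> r \<and> r < d + n then 0 else s r)"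
    by blast
  then have "sem (c ;; clear (d + n)) s s' \<longleftrightarrow>
      s' = (\<lambda>r. if d \<le> r \<and> r < d + Suc n then 0 else s r)" for s s'
    by (simp; auto simp: fun_eq_iff less_Suc_eq)
  then show ?case by blast
qed


section \<open>Counter programs for partial recursive functions\<close>

lemma rec_eval_Zero_iff [simp]: "rec_eval Zero xs z \<longleftrightarrow> z = 0"
  by (subst rec_eval.simps) auto

lemma rec_eval_Succ_iff [simp]: "rec_eval Succ xs z \<longleftrightarrow> (\<exists>x. xs = [x] \<and> z = Suc x)"
  by (subst rec_eval.simps) auto

lemma rec_eval_Proj_iff [simp]: "rec_eval (Proj i) xs z \<longleftrightarrow> i < length xs \<and> z = xs ! i"
  by (subst rec_eval.simps) auto

lemma rec_eval_Comp_iff: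
  "rec_eval (Comp f gs) xs z \<longleftrightarrow> (\<exists>ys. list_all2 (\<lambda>g y. rec_eval g xs y) gs ys \<and> rec_eval f ys z)"
  by (subst rec_eval.simps) auto

lemma rec_eval_PrimRec_0_iff [simp]: "rec_eval (PrimRec f g) (0 # xs) z \<longleftrightarrow> rec_eval f xs z"
  by (subst rec_eval.simps) auto

lemma rec_eval_PrimRec_Suc_iff [simp]:
  "rec_eval (PrimRec f g) (Suc n # xs) z \<longleftrightarrow>
    (\<exists>y. rec_eval (PrimRec f g) (n # xs) y \<and> rec_eval g (n # y # xs) z)"
  by (subst rec_eval.simps) auto

lemma rec_eval_PrimRec_Nil [simp]: "\<not> rec_eval (PrimRec f g) [] z"
  by (subst rec_eval.simps) auto

lemma rec_eval_Mu_iff: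
  "rec_eval (Mu f) xs n \<longleftrightarrow>
    rec_eval f (n # xs) 0 \<and> (\<forall>m<n. \<exists>v. rec_eval f (m # xs) (Suc v))"
  by (subst rec_eval.simps) auto

text \<open>The specification is relational: an undefined value of \<open>f\<close> shows as the
  absence of a final store. As only \<open>t\<close> changes, the scratch registers from
  \<open>b\<close> on are zero again at the end whenever \<open>t < b\<close>, so that programs can
  be chained.\<close>

definition computes :: "recf \<Rightarrow> nat list \<Rightarrow> nat \<Rightarrow> nat \<Rightarrow> com \<Rightarrow> bool" where
  "computes f xs t b c \<longleftrightarrow> (\<forall>s s'. (\<forall>r\<ge>b. s r = 0) \<longrightarrow>
     (sem c s s' \<longleftrightarrow> (\<exists>z. rec_eval f (map s xs) z \<and> s' = s(t := s t + z))))"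

lemma computesI:
  assumes "\<And>s s'. (\<And>r. r \<ge> b \<Longrightarrow> s r = 0) \<Longrightarrow>
     sem c s s' \<longleftrightarrow> (\<exists>z. rec_eval f (map s xs) z \<and> s' = s(t := s t + z))"
  shows "computes f xs t b c"
  using assms by (auto simp: computes_def)

lemma sem_computes:
  assumes "computes f xs t b c" and "\<And>r. r \<ge> b \<Longrightarrow> s r = 0"
  shows "sem c s s' \<longleftrightarrow> (\<exists>z. rec_eval f (map s xs) z \<and> s' = s(t := s t + z))"
  using assms by (auto simp: computes_def)

lemma ex_computes_Proj:
  assumes "set xs \<subseteq> {..<b}" "t < b" "t \<notin> set xs"
  shows "\<exists>c. computes (Proj i) xs t b c"
proof (cases "i < length xs")
  case True
  then have "xs ! i < b" "xs ! i \<noteq> t" using assms by (force dest: nth_mem)+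
  then have "computes (Proj i) xs t b (copy (xs ! i) t b)"
    using True assms by (intro computesI) (auto)
  then show ?thesis ..
next
  case False
  \<comment> \<open>The function is undefined here, and decrementing the scratch register
    \<open>b\<close>, which is zero, has no execution.\<close>
  then have "computes (Proj i) xs t b (Op (Dec b))"
    by (intro computesI) auto
  then show ?thesis ..
qed

lemma ex_computes_Succ:
  assumes "set xs \<subseteq> {..<b}" "t < b" "t \<notin> set xs"
  shows "\<exists>c. computes Succ xs t b c"
proof (cases "\<exists>x. xs = [x]")
  case True
  then obtain x where "xs = [x]" ..
  then have "computes Succ xs t b (copy x t b ;; Op (Inc t))"
    using assms by (intro computesI) (auto)
  then show ?thesis ..
next
  case False
  then have "computes Succ xs t b (Op (Dec b))"
    by (intro computesI) (auto simp: map_eq_Cons_conv)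
  then show ?thesis ..
qed

section \<open>Argument lists and composition\<close>

definition write_list :: "nat \<Rightarrow> nat list \<Rightarrow> store \<Rightarrow> store" where
  "write_list d ys s = (\<lambda>r. if d \<le> r \<and> r < d + length ys then ys ! (r - d) else s r)"

definition computes_list :: "recf list \<Rightarrow> nat list \<Rightarrow> nat \<Rightarrow> com \<Rightarrow> bool" where
  "computes_list gs xs d c \<longleftrightarrow> (\<forall>s s'. (\<forall>r\<ge>d. s r = 0) \<longrightarrow> (sem c s s' \<longleftrightarrow>
     (\<exists>ys. list_all2 (\<lambda>g y. rec_eval g (map s xs) y) gs ys \<and> s' = write_list d ys s)))"

lemma sem_computes_list:
  assumes "computes_list gs xs d c" and "\<And>r. r \<ge> d \<Longrightarrow> s r = 0"
  shows "sem c s s' \<longleftrightarrow>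
    (\<exists>ys. list_all2 (\<lambda>g y. rec_eval g (map s xs) y) gs ys \<and> s' = write_list d ys s)"
  using assms by (auto simp: computes_list_def)

lemma ex_computes_list:
  assumes "\<And>g t b. g \<in> set gs \<Longrightarrow> d \<le> t \<Longrightarrow> t < b \<Longrightarrow> \<exists>c. computes g xs t b c"
    and "set xs \<subseteq> {..<d}"
  shows "\<exists>c. computes_list gs xs d c"
  using assms(1)
proof (induction gs rule: rev_induct)
  case Nil
  obtain c where "\<And>s s'. sem c s s' \<longleftrightarrow> s' = (\<lambda>r. if d \<le> r \<and> r < d + 0 then 0 else s r)"
    using ex_clear_range by blast
  then show ?case by (intro exI[of _ c]) (auto simp: computes_list_def write_list_def)
next
  case (snoc g gs)
  have "\<exists>c. computes_list gs xs d c"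
    by (rule snoc.IH) (use snoc.prems in auto)
  then obtain c where c: "computes_list gs xs d c" ..
  \<comment> \<open>The results are produced from left to right: the earlier ones lie below
    \<open>?t\<close>, the scratch registers above it, so the new call finds its target and scratch
    registers zero.\<close>
  let ?t = "d + length gs"
  obtain c' where c': "computes g xs ?t (Suc ?t) c'"
    using snoc.prems[of g ?t "Suc ?t"] by auto
  have "computes_list (gs @ [g]) xs d (c ;; c')"
    unfolding computes_list_def
  proof (intro allI impI)
    fix s s' assume s: "\<forall>r\<ge>d. s r = (0::nat)"
    let ?P = "\<lambda>g y. rec_eval g (map s xs) y"
    have step: "sem c' (write_list d ys s) u \<longleftrightarrow> (\<exists>y. ?P g y \<and> u = write_list d (ys @ [y]) s)"
      if "length ys = length gs" for ys u
    proof -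
      let ?u = "write_list d ys s"
      have upd: "?u(?t := ?u ?t + y) = write_list d (ys @ [y]) s" for y
        using that s by (auto simp: write_list_def fun_eq_iff nth_append)
      have args: "map ?u xs = map s xs"
        using assms(2) by (auto simp: write_list_def)
      have "?u r = 0" if "r \<ge> Suc ?t" for r
        using that s \<open>length ys = length gs\<close> by (simp add: write_list_def)
      then show ?thesis
        using sem_computes[OF c', of ?u u] by (simp only: upd args)
    qed
    have "sem (c ;; c') s s' \<longleftrightarrow> (\<exists>ys. list_all2 ?P gs ys \<and> sem c' (write_list d ys s) s')"
      using sem_computes_list[OF c, of s] s by auto
    also have "\<dots> \<longleftrightarrow> (\<exists>ys. list_all2 ?P gs ys \<and> (\<exists>y. ?P g y \<and> s' = write_list d (ys @ [y]) s))"
      by (intro ex_cong1 conj_cong refl step) (simp add: list_all2_lengthD)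
    also have "\<dots> \<longleftrightarrow> (\<exists>ys. list_all2 ?P (gs @ [g]) ys \<and> s' = write_list d ys s)"
    proof -
      have "list_all2 ?P (gs @ [g]) zs \<longleftrightarrow> (\<exists>ys y. zs = ys @ [y] \<and> list_all2 ?P gs ys \<and> ?P g y)"
        for zs
      proof
        show "list_all2 ?P (gs @ [g]) zs \<Longrightarrow> \<exists>ys y. zs = ys @ [y] \<and> list_all2 ?P gs ys \<and> ?P g y"
          by (auto simp: list_all2_append1 list_all2_Cons1)
      qed (auto intro: list_all2_appendI)
      then show ?thesis by (simp only:) blast
    qed
    finally show "sem (c ;; c') s s' \<longleftrightarrow>
      (\<exists>ys. list_all2 ?P (gs @ [g]) ys \<and> s' = write_list d ys s)" .
  qed
  then show ?case ..
qed

text \<open>Three phases: the values of \<open>gs\<close> are written to the block of registers from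
  \<open>b\<close> on, \<open>f\<close> is run on this block with scratch registers above it, and
  the block is cleared again.\<close>

lemma ex_computes_Comp:
  assumes f: "\<And>xs t b. set xs \<subseteq> {..<b} \<Longrightarrow> t < b \<Longrightarrow> t \<notin> set xs \<Longrightarrow> \<exists>c. computes f xs t b c"
    and gs: "\<And>g xs t b. g \<in> set gs \<Longrightarrow> set xs \<subseteq> {..<b} \<Longrightarrow> t < b \<Longrightarrow> t \<notin> set xs \<Longrightarrow>
      \<exists>c. computes g xs t b c"
    and xs: "set xs \<subseteq> {..<b}" "t < b" "t \<notin> set xs"
  shows "\<exists>c. computes (Comp f gs) xs t b c"
proof -
  let ?m = "length gs"
  have "\<exists>c. computes_list gs xs b c"
    using xs by (intro ex_computes_list gs) auto
  then obtain c where c: "computes_list gs xs b c" ..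
  have "\<exists>c. computes f [b..<b + ?m] t (b + ?m) c"
    using xs by (intro f) auto
  then obtain c' where c': "computes f [b..<b + ?m] t (b + ?m) c'" ..
  obtain d where d: "\<And>s s'. sem d s s' \<longleftrightarrow> s' = (\<lambda>r. if b \<le> r \<and> r < b + ?m then 0 else s r)"
    using ex_clear_range by blast
  have "computes (Comp f gs) xs t b (c ;; c' ;; d)"
  proof (rule computesI)
    fix s s' assume s: "\<And>r. r \<ge> b \<Longrightarrow> s r = (0::nat)"
    let ?P = "\<lambda>g y. rec_eval g (map s xs) y"
    have step: "sem (c' ;; d) (write_list b ys s) s' \<longleftrightarrow> (\<exists>z. rec_eval f ys z \<and> s' = s(t := s t + z))"
      if "length ys = ?m" for ys
    proof -
      let ?u = "write_list b ys s"
      have "map ?u [b..<b + ?m] = ys"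
        using that by (auto simp: write_list_def intro: nth_equalityI)
      moreover have "?u r = 0" if "r \<ge> b + ?m" for r
        using that s \<open>length ys = ?m\<close> by (simp add: write_list_def)
      ultimately have "sem c' ?u v \<longleftrightarrow> (\<exists>z. rec_eval f ys z \<and> v = ?u(t := ?u t + z))" for v
        using sem_computes[OF c', of ?u v] by simp
      moreover have "(\<lambda>r. if b \<le> r \<and> r < b + ?m then 0 else (?u(t := ?u t + z)) r)
          = s(t := s t + z)" for z
        using that s xs by (auto simp: write_list_def fun_eq_iff)
      ultimately show ?thesis by (auto simp: d)
    qed
    have "sem (c ;; c' ;; d) s s' \<longleftrightarrow>
        (\<exists>ys. list_all2 ?P gs ys \<and> sem (c' ;; d) (write_list b ys s) s')"
      unfolding sem_Seq[of c] using sem_computes_list[OF c, of s] s by auto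
    also have "\<dots> \<longleftrightarrow>
        (\<exists>ys. list_all2 ?P gs ys \<and> (\<exists>z. rec_eval f ys z \<and> s' = s(t := s t + z)))"
      by (intro ex_cong1 conj_cong refl step) (simp add: list_all2_lengthD)
    also have "\<dots> \<longleftrightarrow> (\<exists>z. rec_eval (Comp f gs) (map s xs) z \<and> s' = s(t := s t + z))"
      by (auto simp: rec_eval_Comp_iff)
    finally show "sem (c ;; c' ;; d) s s' \<longleftrightarrow>
      (\<exists>z. rec_eval (Comp f gs) (map s xs) z \<and> s' = s(t := s t + z))" .
  qed
  then show ?thesis ..
qed

text \<open>Register \<open>b\<close> holds the candidate and \<open>?v\<close> the value of
  \<open>f\<close> there. Another round requires a positive value, because of \<open>Dec\<close>,
  and the exit requires zero, because of \<open>Test\<close>; leaving the loop at the wrong moment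
  gets stuck.\<close>

lemma ex_computes_Mu:
  assumes f: "\<And>xs t b. set xs \<subseteq> {..<b} \<Longrightarrow> t < b \<Longrightarrow> t \<notin> set xs \<Longrightarrow> \<exists>c. computes f xs t b c"
    and xs: "set xs \<subseteq> {..<b}" "t < b" "t \<notin> set xs"
  shows "\<exists>c. computes (Mu f) xs t b c"
proof -
  let ?v = "Suc b"
  have "\<exists>c. computes f (b # xs) ?v (Suc ?v) c"
    using xs by (intro f) auto
  then obtain c where c: "computes f (b # xs) ?v (Suc ?v) c" ..
  let ?body = "c ;; Op (Dec ?v) ;; clear ?v ;; Op (Inc b)"
  have "computes (Mu f) xs t b (Star ?body ;; c ;; Op (Test ?v) ;; move b t)"
  proof (rule computesI)
    fix s s' assume s: "\<And>r. r \<ge> b \<Longrightarrow> s r = (0::nat)"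
    have b: "b \<notin> set xs" using xs by auto
    have run: "sem c (s(b := i)) u \<longleftrightarrow> (\<exists>z. rec_eval f (i # map s xs) z \<and> u = s(b := i, ?v := z))"
      for i u
      using sem_computes[OF c, of "s(b := i)" u] s b by auto
    have body: "sem ?body (s(b := i)) u \<longleftrightarrow>
        (\<exists>v. rec_eval f (i # map s xs) (Suc v)) \<and> u = s(b := Suc i)" (is "_ \<longleftrightarrow> ?r") for i u
    proof -
      have "sem ?body (s(b := i)) u \<longleftrightarrow> (\<exists>z. rec_eval f (i # map s xs) z \<and>
          sem (Op (Dec ?v) ;; clear ?v ;; Op (Inc b)) (s(b := i, ?v := z)) u)"
        unfolding sem_Seq[of c] run by blast
      also have "\<dots> \<longleftrightarrow> (\<exists>z. rec_eval f (i # map s xs) z \<and> z > 0 \<and> u = s(b := Suc i))"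
        using s[of ?v] by (auto simp: fun_upd_twist fun_upd_idem)
      also have "\<dots> \<longleftrightarrow> ?r" by (auto simp: gr0_conv_Suc)
      finally show ?thesis .
    qed
    have star: "sem (Star ?body) s u \<longleftrightarrow>
        (\<exists>j. (\<forall>m<j. \<exists>v. rec_eval f (m # map s xs) (Suc v)) \<and> u = s(b := j))" for u
      using sem_Star_counted_iff[of ?body "\<lambda>i. s(b := i)"
          "\<lambda>i. \<exists>v. rec_eval f (i # map s xs) (Suc v)" u, OF body] s[of b]
      by (simp add: fun_upd_idem)
    have rest: "sem (c ;; Op (Test ?v) ;; move b t) (s(b := j)) s' \<longleftrightarrow>
        rec_eval f (j # map s xs) 0 \<and> s' = s(t := s t + j)" for j
    proof -
      have "sem (c ;; Op (Test ?v) ;; move b t) (s(b := j)) s' \<longleftrightarrow>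
          (\<exists>z. rec_eval f (j # map s xs) z \<and>
            sem (Op (Test ?v) ;; move b t) (s(b := j, ?v := z)) s')"
        unfolding sem_Seq[of c] run by blast
      also have "\<dots> \<longleftrightarrow> rec_eval f (j # map s xs) 0 \<and> s' = s(t := s t + j)"
        using s[of b] s[of ?v] xs by (auto simp: fun_upd_twist fun_upd_idem)
      finally show ?thesis .
    qed
    have "sem (Star ?body ;; c ;; Op (Test ?v) ;; move b t) s s' \<longleftrightarrow>
       (\<exists>u. sem (Star ?body) s u \<and> sem (c ;; Op (Test ?v) ;; move b t) u s')"
      by (rule sem_Seq)
    also have "\<dots> \<longleftrightarrow> (\<exists>z. rec_eval (Mu f) (map s xs) z \<and> s' = s(t := s t + z))"
      unfolding star using rest by (auto simp: rec_eval_Mu_iff simp del: sem_Seq)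
    finally show "sem (Star ?body ;; c ;; Op (Test ?v) ;; move b t) s s' \<longleftrightarrow>
      (\<exists>z. rec_eval (Mu f) (map s xs) z \<and> s' = s(t := s t + z))" .
  qed
  then show ?thesis ..
qed

text \<open>The recursion is evaluated upwards from 0. Register \<open>?i\<close> holds the index,
  \<open>?y\<close> the value at this index, \<open>?z\<close> the next value and \<open>?m\<close>
  the number of rounds that remain; \<open>?m\<close> starts as a copy because the argument
  \<open>x\<close> has to survive.\<close>

lemma ex_computes_PrimRec:
  assumes f: "\<And>xs t b. set xs \<subseteq> {..<b} \<Longrightarrow> t < b \<Longrightarrow> t \<notin> set xs \<Longrightarrow> \<exists>c. computes f xs t b c"
    and g: "\<And>xs t b. set xs \<subseteq> {..<b} \<Longrightarrow> t < b \<Longrightarrow> t \<notin> set xs \<Longrightarrow> \<exists>c. computes g xs t b c"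
    and xs: "set xs \<subseteq> {..<b}" "t < b" "t \<notin> set xs"
  shows "\<exists>c. computes (PrimRec f g) xs t b c"
proof (cases xs)
  case Nil
  then have "computes (PrimRec f g) xs t b (Op (Dec b))"
    by (intro computesI) auto
  then show ?thesis ..
next
  case (Cons x ys)
  let ?i = b and ?y = "b + 1" and ?z = "b + 2" and ?m = "b + 3" and ?e = "b + 4"
  have "\<exists>c. computes f ys ?y ?e c"
    using xs Cons by (intro f) auto
  then obtain c where c: "computes f ys ?y ?e c" ..
  have "\<exists>c. computes g (?i # ?y # ys) ?z ?e c"
    using xs Cons by (intro g) auto
  then obtain c' where c': "computes g (?i # ?y # ys) ?z ?e c'" ..
  let ?body = "Op (Dec ?m) ;; c' ;; clear ?y ;; move ?z ?y ;; Op (Inc ?i)"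
  let ?end = "Op (Test ?m) ;; move ?y t ;; clear ?i"
  have "computes (PrimRec f g) xs t b (copy x ?m ?e ;; c ;; Star ?body ;; ?end)"
  proof (rule computesI)
    fix s s' assume s: "\<And>r. r \<ge> b \<Longrightarrow> s r = (0::nat)"
    let ?as = "map s ys"
    define S where "S = (\<lambda>i y. s(?m := s x - i, ?i := i, ?y := y))"
    define P where "P = (\<lambda>i y. i \<le> s x \<and> rec_eval (PrimRec f g) (i # ?as) y)"
    have notin: "?i \<notin> set ys" "?y \<notin> set ys" "?z \<notin> set ys" "?m \<notin> set ys" "t \<noteq> x" "x < b"
      using xs Cons by auto
    have body: "sem ?body (S i y) u \<longleftrightarrow>
        i < s x \<and> (\<exists>z. rec_eval g (i # y # ?as) z \<and> u = S (Suc i) z)" for i y u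
    proof -
      let ?T = "s(?m := s x - Suc i, ?i := i, ?y := y)"
      let ?next = "clear ?y ;; move ?z ?y ;; Op (Inc ?i)"
      have dec: "sem (Op (Dec ?m)) (S i y) v \<longleftrightarrow> i < s x \<and> v = ?T" for v
        by (auto simp: S_def fun_upd_twist)
      have run: "sem c' ?T v \<longleftrightarrow> (\<exists>z. rec_eval g (i # y # ?as) z \<and> v = ?T(?z := z))" for v
        using sem_computes[OF c', of ?T v] s notin by auto
      have "S (Suc i) z = ?T(?z := z, ?y := 0, ?z := 0, ?y := z, ?i := Suc i)" for z
        using s[of ?z] by (auto simp: S_def fun_eq_iff)
      then have "sem ?next (?T(?z := z)) v \<longleftrightarrow> v = S (Suc i) z" for v z
        by simp
      then have "sem (c' ;; ?next) ?T u \<longleftrightarrow> (\<exists>z. rec_eval g (i # y # ?as) z \<and> u = S (Suc i) z)"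
        unfolding sem_Seq[of c'] run by blast
      then show ?thesis
        unfolding sem_Seq[of "Op (Dec ?m)"] dec by blast
    qed
    \<comment> \<open>By determinism \<open>P i y\<close> leaves only one possible \<open>y\<close>,
      so the value computed from it is the value at \<open>Suc i\<close>.\<close>
    have step: "sem ?body (S i y) u \<longleftrightarrow> (\<exists>z. P (Suc i) z \<and> u = S (Suc i) z)" if "P i y" for i y u
      unfolding body using that by (auto simp: P_def Suc_le_eq dest: rec_eval_det)
    have loop: "sem (Star ?body) (S 0 y) u \<longleftrightarrow> (\<exists>j z. P j z \<and> u = S j z)"
      if "rec_eval f ?as y" for y u
      by (rule sem_Star_indexed_iff[of P, OF _ _ step])
        (use that in \<open>auto simp: P_def dest: rec_eval_det\<close>)
    have fin: "sem ?end (S j z) s' \<longleftrightarrow> j = s x \<and> s' = s(t := s t + z)" if "P j z" for j z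
    proof -
      have test: "sem (Op (Test ?m)) (S j z) v \<longleftrightarrow> j = s x \<and> v = S (s x) z" for v
        using that by (auto simp: S_def P_def)
      have "S (s x) z = s(?i := s x, ?y := z)"
        using s by (auto simp: S_def fun_eq_iff)
      moreover have "s(t := s t + z) = s(?i := s x, ?y := 0, t := s t + z, ?i := 0)"
        using s xs by (auto simp: fun_eq_iff)
      ultimately have "sem (move ?y t ;; clear ?i) (S (s x) z) s' \<longleftrightarrow> s' = s(t := s t + z)"
        using xs by simp
      then show ?thesis
        unfolding sem_Seq[of "Op (Test ?m)"] test by blast
    qed
    have start: "sem (copy x ?m ?e ;; c) s u \<longleftrightarrow> (\<exists>y. rec_eval f ?as y \<and> u = S 0 y)" for u
    proof -
      have "sem (copy x ?m ?e) s v \<longleftrightarrow> v = s(?m := s x)" for v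
        using sem_copy[of x ?m ?e s v] notin s by auto
      moreover have "sem c (s(?m := s x)) u \<longleftrightarrow> (\<exists>y. rec_eval f ?as y \<and> u = S 0 y)"
      proof -
        have "s(?m := s x, ?y := y) = S 0 y" for y
          using s[of ?i] by (auto simp: S_def fun_eq_iff)
        then show ?thesis
          using sem_computes[OF c, of "s(?m := s x)" u] s notin by auto
      qed
      ultimately show ?thesis by auto
    qed
    have "sem (copy x ?m ?e ;; c ;; Star ?body ;; ?end) s s' \<longleftrightarrow>
      (\<exists>u v. sem (copy x ?m ?e ;; c) s u \<and> sem (Star ?body) u v \<and> sem ?end v s')"
      unfolding sem_Seq by blast
    also have "\<dots> \<longleftrightarrow>
        (\<exists>y. rec_eval f ?as y \<and> (\<exists>v. sem (Star ?body) (S 0 y) v \<and> sem ?end v s'))"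
      unfolding start by blast
    also have "\<dots> \<longleftrightarrow> (\<exists>y. rec_eval f ?as y \<and> (\<exists>j z. P j z \<and> sem ?end (S j z) s'))"
      by (intro ex_cong1 conj_cong refl) (simp only: loop, blast)
    also have "\<dots> \<longleftrightarrow> (\<exists>y. rec_eval f ?as y \<and> (\<exists>z. P (s x) z \<and> s' = s(t := s t + z)))"
    proof -
      have "P j z \<and> sem ?end (S j z) s' \<longleftrightarrow> P j z \<and> j = s x \<and> s' = s(t := s t + z)" for j z
        by (intro conj_cong refl fin)
      then show ?thesis by (simp only:) blast
    qed
    also have "\<dots> \<longleftrightarrow> (\<exists>z. P (s x) z \<and> s' = s(t := s t + z))"
    proof -
      \<comment> \<open>A value at \<open>n\<close> presupposes one at 0, so the condition on
        \<open>f\<close> is absorbed by \<open>P\<close>.\<close>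
      have "\<exists>y. rec_eval f ?as y" if "rec_eval (PrimRec f g) (n # ?as) z" for n z
        using that by (induction n arbitrary: z) auto
      then show ?thesis by (auto simp: P_def)
    qed
    finally show "sem (copy x ?m ?e ;; c ;; Star ?body ;; ?end) s s' \<longleftrightarrow>
      (\<exists>z. rec_eval (PrimRec f g) (map s xs) z \<and> s' = s(t := s t + z))"
      by (simp add: P_def Cons)
  qed
  then show ?thesis ..
qed

text \<open>The registers are arbitrary in the induction, because each subfunction is called on
  registers of its own.\<close>

lemma ex_computes:
  "set xs \<subseteq> {..<b} \<Longrightarrow> t < b \<Longrightarrow> t \<notin> set xs \<Longrightarrow> \<exists>c. computes f xs t b c"
proof (induction f arbitrary: xs t b)
  case Zero
  \<comment> \<open>Clearing an empty range does nothing, which is the same as adding 0 to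
    \<open>t\<close>.\<close>
  obtain c where "\<And>s s'. sem c s s' \<longleftrightarrow> s' = (\<lambda>r. if 0 \<le> r \<and> r < 0 + 0 then 0 else s r)"
    using ex_clear_range by blast
  then have "computes Zero xs t b c"
    by (intro computesI) auto
  then show ?case ..
next
  case Succ
  then show ?case by (rule ex_computes_Succ)
next
  case (Proj i)
  then show ?case by (rule ex_computes_Proj)
next
  case (Comp f gs)
  show ?case by (rule ex_computes_Comp[OF Comp.IH Comp.prems])
next
  case (PrimRec f g)
  show ?case by (rule ex_computes_PrimRec[OF PrimRec.IH PrimRec.prems])
next
  case (Mu f)
  show ?case by (rule ex_computes_Mu[OF Mu.IH Mu.prems])
qed


section \<open>Finite control\<close>

text \<open>The control states of a program are stacks of commands that remain to be executed.\<close>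

inductive stack_step :: "com list \<times> store \<Rightarrow> com list \<times> store \<Rightarrow> bool" where
  Op: "op_sem a s s' \<Longrightarrow> stack_step (Op a # k, s) (k, s')"
| Seq: "stack_step ((c ;; d) # k, s) (c # d # k, s)"
| Star_exit: "stack_step (Star c # k, s) (k, s)"
| Star_iter: "stack_step (Star c # k, s) (c # Star c # k, s)"

fun sems :: "com list \<Rightarrow> store \<Rightarrow> store \<Rightarrow> bool" where
  "sems [] s s' \<longleftrightarrow> s' = s"
| "sems (c # k) s s' \<longleftrightarrow> (\<exists>u. sem c s u \<and> sems k u s')"

text \<open>The big-step meaning of a stack is preserved backwards along a step; starting from the
  empty stack, converse induction then turns a small-step execution into a big-step one.\<close>

lemma sems_stack_step:
  assumes "stack_step (k, s) (k', u)" "sems k' u s'"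
  shows "sems k s s'"
  using assms(1)
proof cases
  case (Star_iter c l)
  then obtain v where v: "sem c s v" "sems (Star c # l) v s'" using assms(2) by auto
  then obtain w where "(sem c)\<^sup>*\<^sup>* v w" "sems l w s'" by (auto simp: sem.simps)
  then show ?thesis
    using v Star_iter by (auto simp: sem.simps intro: converse_rtranclp_into_rtranclp)
qed (use assms(2) in \<open>auto simp: sem.simps(3)\<close>)

lemma stack_steps_sem:
  "sem c s s' \<Longrightarrow> stack_step\<^sup>*\<^sup>* (c # k, s) (k, s')"
proof (induction c arbitrary: k s s')
  case (Op a)
  then show ?case by (auto intro: stack_step.Op)
next
  case (Seq c d)
  then obtain u where "sem c s u" "sem d u s'" by auto
  then have "stack_step\<^sup>*\<^sup>* (c # d # k, s) (k, s')"
    using Seq.IH by (meson rtranclp_trans)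
  then show ?case by (meson converse_rtranclp_into_rtranclp stack_step.Seq)
next
  case (Star c)
  from Star.prems have "(sem c)\<^sup>*\<^sup>* s s'" by (simp add: sem.simps)
  then show ?case
  proof (induction rule: converse_rtranclp_induct)
    case base
    show ?case by (simp add: stack_step.Star_exit r_into_rtranclp)
  next
    case (step s u)
    have "stack_step (Star c # k, s) (c # Star c # k, s)" by (rule stack_step.Star_iter)
    also have "stack_step\<^sup>*\<^sup>* (c # Star c # k, s) (Star c # k, u)" by (rule Star.IH[OF step.hyps(1)])
    also note step.IH
    finally show ?case .
  qed
qed

lemma stack_steps_iff: "stack_step\<^sup>*\<^sup>* ([c], s) ([], s') \<longleftrightarrow> sem c s s'"
proof
  have "sems (fst x) (snd x) s'" if "stack_step\<^sup>*\<^sup>* x ([], s')" for x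
    using that
    by (induction rule: converse_rtranclp_induct) (auto dest: sems_stack_step)
  from this[of "([c], s)"] show "stack_step\<^sup>*\<^sup>* ([c], s) ([], s') \<Longrightarrow> sem c s s'" by simp
qed (rule stack_steps_sem)

text \<open>These finitely many stacks contain all that an execution of \<open>c\<close> above
  \<open>k\<close> passes through before it is left with \<open>k\<close>. Finiteness is possible
  because an iteration of \<open>Star c\<close> returns to the same stack, so control needs no
  memory of the number of rounds.\<close>

primrec stacks :: "com \<Rightarrow> com list \<Rightarrow> com list set" where
  "stacks (Op a) k = {Op a # k}"
| "stacks (Seq c d) k = insert ((c ;; d) # k) (stacks c (d # k) \<union> stacks d k)"
| "stacks (Star c) k = insert (Star c # k) (stacks c (Star c # k))"

lemma finite_stacks: "finite (stacks c k)"
  by (induction c arbitrary: k) auto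

lemma Nil_notin_stacks: "[] \<notin> stacks c k"
  by (induction c arbitrary: k) auto

lemma Cons_in_stacks [simp]: "c # k \<in> stacks c k"
  by (cases c) auto

lemma stack_step_in_stacks:
  "l \<in> stacks c k \<Longrightarrow> stack_step (l, s) (l', s') \<Longrightarrow> l' \<in> insert k (stacks c k)"
proof (induction c arbitrary: k)
  case (Op a)
  then show ?case by (auto elim: stack_step.cases)
next
  case (Seq c d)
  consider "l = (c ;; d) # k" | "l \<in> stacks c (d # k)" | "l \<in> stacks d k"
    using Seq.prems(1) by auto
  then show ?case
  proof cases
    case 1
    with Seq.prems(2) show ?thesis by (auto elim: stack_step.cases)
  next
    case 2
    from Seq.IH(1)[OF this Seq.prems(2)] show ?thesis by auto
  next
    case 3
    from Seq.IH(2)[OF this Seq.prems(2)] show ?thesis by auto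
  qed
next
  case (Star c)
  consider "l = Star c # k" | "l \<in> stacks c (Star c # k)"
    using Star.prems(1) by auto
  then show ?case
  proof cases
    case 1
    with Star.prems(2) show ?thesis by (auto elim: stack_step.cases)
  next
    case 2
    from Star.IH[OF this Star.prems(2)] show ?thesis by auto
  qed
qed


section \<open>Counter machines\<close>

datatype instr = Do operation nat | Goto "nat set"

inductive step :: "(nat \<Rightarrow> instr) \<Rightarrow> nat \<times> store \<Rightarrow> nat \<times> store \<Rightarrow> bool" for prog where
  Do: "prog p = Do a q \<Longrightarrow> op_sem a s s' \<Longrightarrow> step prog (p, s) (q, s')"
| Goto: "prog p = Goto Q \<Longrightarrow> q \<in> Q \<Longrightarrow> step prog (p, s) (q, s)"

definition halts :: "(nat \<Rightarrow> instr) \<Rightarrow> nat \<Rightarrow> store \<Rightarrow> bool" where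
  "halts prog p s \<longleftrightarrow> (\<exists>s'. (step prog)\<^sup>*\<^sup>* (p, s) (0, s'))"

fun register :: "operation \<Rightarrow> nat" where
  "register (Inc r) = r"
| "register (Dec r) = r"
| "register (Test r) = r"

fun valid_instr :: "nat \<Rightarrow> nat \<Rightarrow> instr \<Rightarrow> bool" where
  "valid_instr R t (Do a q) \<longleftrightarrow> register a < R \<and> q \<le> t"
| "valid_instr R t (Goto Q) \<longleftrightarrow> Q \<subseteq> {..t}"

text \<open>Each line above \<open>t\<close> has exactly one step, which increments register 0 and
  goes to the line below; the chain neither branches nor halts before \<open>t\<close>.\<close>

lemma halts_input:
  assumes "\<And>p. p > t \<Longrightarrow> prog p = Do (Inc 0) (p - 1)"
  shows "halts prog (t + n) s \<longleftrightarrow> halts prog t (s(0 := s 0 + n))"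
proof (induction n arbitrary: s)
  case 0
  then show ?case by simp
next
  case (Suc n)
  have step: "step prog (t + Suc n, s) x \<longleftrightarrow> x = (t + n, s(0 := Suc (s 0)))" for x
    using assms[of "t + Suc n"] by (auto simp: step.simps)
  have "halts prog (t + Suc n) s \<longleftrightarrow> halts prog (t + n) (s(0 := Suc (s 0)))"
  proof
    assume "halts prog (t + Suc n) s"
    then obtain s' where "(step prog)\<^sup>*\<^sup>* (t + Suc n, s) (0, s')" by (auto simp: halts_def)
    then show "halts prog (t + n) (s(0 := Suc (s 0)))"
      by (cases rule: converse_rtranclpE) (auto simp: step[simplified] halts_def)
  next
    assume "halts prog (t + n) (s(0 := Suc (s 0)))"
    then show "halts prog (t + Suc n) s"
      unfolding halts_def using step by (blast intro: converse_rtranclp_into_rtranclp)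
  qed
  moreover have "(s(0 := Suc (s 0)))(0 := (s(0 := Suc (s 0))) 0 + n) = s(0 := s 0 + Suc n)"
    by simp
  ultimately show ?case by (simp only: Suc.IH)
qed

text \<open>The lines above \<open>t\<close> load a number into register \<open>0\<close> before the program is entered
  at line \<open>t\<close>.\<close>

lemma ex_program:
  "\<exists>R t prog. 0 < R \<and> (\<forall>p\<le>t. valid_instr R t (prog p)) \<and>
     (\<forall>p>t. prog p = Do (Inc 0) (p - 1)) \<and> (\<forall>s. halts prog t s \<longleftrightarrow> (\<exists>s'. sem c s s'))"
proof -
  obtain ys where ys: "set ys = stacks c [] - {[c]}" "distinct ys"
    using finite_stacks[of c "[]"] finite_distinct_list by blast
  define ks where "ks = [] # ys @ [[c]]"
  define t where "t = Suc (length ys)"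
  have ks: "distinct ks" "set ks = insert [] (stacks c [])" "ks ! 0 = []" "ks ! t = [c]"
    using ys Nil_notin_stacks by (auto simp: ks_def t_def)
  have len: "length ks = Suc t" by (simp add: ks_def t_def)
  define lab where "lab = inv_into {..t} ((!) ks)"
  have inj: "inj_on ((!) ks) {..t}"
    using ks(1) len by (auto simp: inj_on_def nth_eq_iff_index_eq)
  have image: "(!) ks ` {..t} = set ks"
    using len by (auto simp: set_conv_nth image_iff less_Suc_eq_le)
  have lab_nth: "lab (ks ! p) = p" if "p \<le> t" for p
    using that inj by (simp add: lab_def)
  have nth_lab: "ks ! lab k = k" and lab_le: "lab k \<le> t" if "k \<in> set ks" for k
    using that image f_inv_into_f[of k "(!) ks" "{..t}"] inv_into_into[of k "(!) ks" "{..t}"]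
    by (auto simp: lab_def)
  \<comment> \<open>Rearranging the stack becomes a jump; the choice between leaving and iterating a
    loop becomes a jump with two targets.\<close>
  define instr where "instr = (\<lambda>k. case k of [] \<Rightarrow> Goto {} | c # k \<Rightarrow> (case c of
      Op a \<Rightarrow> Do a (lab k)
    | Seq c d \<Rightarrow> Goto {lab (c # d # k)}
    | Star c \<Rightarrow> Goto {lab k, lab (c # Star c # k)}))"
  define prog where "prog = (\<lambda>p. if p \<le> t then instr (ks ! p) else Do (Inc 0) (p - 1))"
  have closed: "k' \<in> set ks" if "k \<in> set ks" "stack_step (k, s) (k', s')" for k k' s s'
    using that stack_step_in_stacks[of k c "[]" s k' s'] ks(2) by (auto elim: stack_step.cases)
  have step_lab: "step prog (lab k, s) (lab k', s')"
    if "k \<in> set ks" "stack_step (k, s) (k', s')" for k k' s s'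
    using that(2) that(1) nth_lab[OF that(1)] lab_le[OF that(1)]
    by cases (auto simp: step.simps prog_def instr_def)
  have stack_nth: "q \<le> t \<and> stack_step (ks ! p, s) (ks ! q, s')"
    if "p \<le> t" "step prog (p, s) (q, s')" for p q s s'
  proof -
    have p: "ks ! p \<in> set ks" using that(1) len by simp
    have "\<exists>k'. q = lab k' \<and> stack_step (ks ! p, s) (k', s')"
      using that(2)
    proof cases
      case (Do a)
      then show ?thesis
        using that(1) by (auto simp: prog_def instr_def intro: stack_step.Op
            split: list.splits com.splits)
    next
      case (Goto Q)
      then show ?thesis
        using that(1) by (auto simp: prog_def instr_def intro: stack_step.intros
            split: list.splits com.splits)
    qed
    then obtain k' where k': "q = lab k'" "stack_step (ks ! p, s) (k', s')" by blast
    show ?thesis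
      using k' closed[OF p k'(2)] nth_lab lab_le by simp
  qed
  have "finite (register ` {a. \<exists>k. Op a # k \<in> set ks})"
  proof -
    have "{a. \<exists>k. Op a # k \<in> set ks} \<subseteq> (\<lambda>k. case hd k of Op a \<Rightarrow> a) ` set ks"
      by (auto intro: rev_image_eqI)
    then show ?thesis using finite_surj finite_set by blast
  qed
  \<comment> \<open>Adding 0 to the registers of the program makes \<open>R\<close> positive, as the
    loading lines use register 0.\<close>
  then obtain R where R: "\<forall>r\<in>insert 0 (register ` {a. \<exists>k. Op a # k \<in> set ks}). r < R"
    by (meson finite_insert finite_nat_set_iff_bounded)
  have valid: "valid_instr R t (prog p)" if "p \<le> t" for p
  proof -
    have p: "ks ! p \<in> set ks" using that len by simp
    show ?thesis
    proof (cases "ks ! p")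
      case Nil
      then show ?thesis using that by (simp add: prog_def instr_def)
    next
      case (Cons d k)
      show ?thesis
      proof (cases d)
        case (Op a)
        have "stack_step (ks ! p, s) (k, s')" if "op_sem a s s'" for s s'
          using that Cons Op by (auto intro: stack_step.Op)
        \<comment> \<open>\<open>closed\<close> speaks of actual steps, so a store that enables the
          operation is needed: all ones, or all zeros for a test.\<close>
        moreover have "\<exists>s s'. op_sem a s s'"
          by (cases a) (auto intro: exI[of _ "\<lambda>_. 1"] exI[of _ "\<lambda>_. 0"])
        ultimately have "k \<in> set ks" using closed[OF p] by blast
        then show ?thesis using that p R Cons Op lab_le
          by (auto simp: prog_def instr_def)
      next
        case (Seq d1 d2)
        then have "stack_step (ks ! p, s) (d1 # d2 # k, s)" for s
          using Cons by (auto intro: stack_step.Seq)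
        then have "d1 # d2 # k \<in> set ks" using closed[OF p] by blast
        then show ?thesis using that Cons Seq lab_le
          by (auto simp: prog_def instr_def)
      next
        case (Star d)
        then have "stack_step (ks ! p, s) (k, s)" "stack_step (ks ! p, s) (d # Star d # k, s)" for s
          using Cons by (auto intro: stack_step.Star_exit stack_step.Star_iter)
        then have "k \<in> set ks" "d # Star d # k \<in> set ks" using closed[OF p] by blast+
        then show ?thesis using that Cons Star lab_le
          by (auto simp: prog_def instr_def)
      qed
    qed
  qed
  have "halts prog t s \<longleftrightarrow> (\<exists>s'. sem c s s')" for s
  proof
    assume "\<exists>s'. sem c s s'"
    then obtain s' where steps: "stack_step\<^sup>*\<^sup>* ([c], s) ([], s')"
      by (auto simp: stack_steps_iff)
    have "fst y \<in> set ks \<and> (step prog)\<^sup>*\<^sup>* (lab (fst x), snd x) (lab (fst y), snd y)"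
      if "stack_step\<^sup>*\<^sup>* x y" "fst x \<in> set ks" for x y
      using that
    proof (induction rule: rtranclp_induct)
      case (step y z)
      then show ?case
        using closed[of "fst y" "snd y" "fst z" "snd z"]
          step_lab[of "fst y" "snd y" "fst z" "snd z"]
        by (auto intro: rtranclp.rtrancl_into_rtrancl)
    qed auto
    from this[OF steps] have "(step prog)\<^sup>*\<^sup>* (lab [c], s) (lab [], s')"
      using ks(2) by simp
    then show "halts prog t s"
      using lab_nth[of t] lab_nth[of 0] ks by (auto simp: halts_def)
  next
    assume "halts prog t s"
    then obtain s' where steps: "(step prog)\<^sup>*\<^sup>* (t, s) (0, s')" by (auto simp: halts_def)
    have "fst y \<le> t \<and> stack_step\<^sup>*\<^sup>* (ks ! fst x, snd x) (ks ! fst y, snd y)"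
      if "(step prog)\<^sup>*\<^sup>* x y" "fst x \<le> t" for x y
      using that
    proof (induction rule: rtranclp_induct)
      case (step y z)
      then show ?case
        using stack_nth[of "fst y" "snd y" "fst z" "snd z"]
        by (auto intro: rtranclp.rtrancl_into_rtrancl)
    qed auto
    from this[of "(t, s)" "(0, s')"] have "stack_step\<^sup>*\<^sup>* ([c], s) ([], s')"
      using steps ks by simp
    then show "\<exists>s'. sem c s s'" by (auto simp: stack_steps_iff)
  qed
  moreover have "prog p = Do (Inc 0) (p - 1)" if "p > t" for p
    using that by (simp add: prog_def)
  ultimately show ?thesis using R valid by blast
qed


section \<open>Deadlocked runs as reachability\<close>

lemma bc_trans_in_states: "(c, c') \<in> bc_trans B \<Longrightarrow> c \<in> bc_states B \<and> c' \<in> bc_states B"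
  by (auto simp: bc_trans_def)

lemma finite_path_snoc:
  "finite_path B cs \<Longrightarrow> finite_path B (cs @ [c]) \<longleftrightarrow> (last cs, c) \<in> bc_trans B"
  by (auto simp: finite_path_def successively_append_iff dest: bc_trans_in_states)

lemma finite_path_rtrancl: "finite_path B cs \<Longrightarrow> (hd cs, last cs) \<in> (bc_trans B)\<^sup>*"
proof (induction cs rule: rev_induct)
  case (snoc c cs)
  show ?case
  proof (cases "cs = []")
    case False
    with snoc.prems have "finite_path B cs" "(last cs, c) \<in> bc_trans B"
      by (auto simp: finite_path_def successively_append_iff)
    with snoc.IH False show ?thesis by (auto intro: rtrancl_into_rtrancl)
  qed simp
qed (simp add: finite_path_def)

lemma rtrancl_finite_path:
  assumes "(c, c') \<in> (bc_trans B)\<^sup>*" "c \<in> bc_states B"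
  shows "\<exists>cs. finite_path B cs \<and> hd cs = c \<and> last cs = c'"
  using assms(1)
proof (induction rule: rtrancl_induct)
  case base
  show ?case using assms(2) by (intro exI[of _ "[c]"]) (simp add: finite_path_def)
next
  case (step d e)
  then obtain cs where cs: "finite_path B cs" "hd cs = c" "last cs = d" by blast
  then have "finite_path B (cs @ [e])" using step.hyps(2) by (simp add: finite_path_snoc)
  moreover have "cs \<noteq> []" using cs(1) by (simp add: finite_path_def)
  ultimately show ?case using cs(2) by (intro exI[of _ "cs @ [e]"]) simp
qed

text \<open>Whether a finite path can be extended depends on its last state only.\<close>

lemma has_deadlocked_run_iff:
  "has_deadlocked_run B \<longleftrightarrow>
    (\<exists>c\<in>bc_initial B. \<exists>d. (c, d) \<in> (bc_trans B)\<^sup>* \<and> (\<forall>e. (d, e) \<notin> bc_trans B))"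
proof
  assume "has_deadlocked_run B"
  then obtain cs where "deadlocked_run B cs" by (auto simp: has_deadlocked_run_def)
  then show "\<exists>c\<in>bc_initial B. \<exists>d. (c, d) \<in> (bc_trans B)\<^sup>* \<and> (\<forall>e. (d, e) \<notin> bc_trans B)"
    using finite_path_rtrancl[of B cs] finite_path_snoc[of B cs]
    by (auto simp: deadlocked_run_def)
next
  assume "\<exists>c\<in>bc_initial B. \<exists>d. (c, d) \<in> (bc_trans B)\<^sup>* \<and> (\<forall>e. (d, e) \<notin> bc_trans B)"
  then obtain c d where cd: "c \<in> bc_initial B" "(c, d) \<in> (bc_trans B)\<^sup>*" "\<And>e. (d, e) \<notin> bc_trans B"
    by blast
  then obtain cs where "finite_path B cs" "hd cs = c" "last cs = d"
    using rtrancl_finite_path[of c d B] by (auto simp: bc_initial_def)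
  then have "deadlocked_run B cs"
    using cd finite_path_snoc[of B cs] by (auto simp: deadlocked_run_def)
  then show "has_deadlocked_run B" by (auto simp: has_deadlocked_run_def)
qed


section \<open>Broadcast templates simulating counter machines\<close>

text \<open>The template for the lines \<open>0, \<dots>, t\<close> of a machine with registers \<open>0, \<dots>, R - 1\<close>. Its
  states are: 0, a trap that is never deadlocked; 1, dead; 2, initial; 3, idle; \<open>4 + r\<close>, a unit of
  register \<open>r\<close>; \<open>4 + R + p\<close>, control at line \<open>p\<close>. Its actions are: \<open>3 * r\<close>, \<open>3 * r + 1\<close>,
  \<open>3 * r + 2\<close>, the three operations on register \<open>r\<close>; \<open>3 * R\<close>, start; \<open>3 * R + 1\<close>, halt.\<close>

definition receive :: "nat \<Rightarrow> (nat \<Rightarrow> instr) \<Rightarrow> nat \<Rightarrow> nat \<Rightarrow> nat" where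
  "receive R prog a q =
    (if q < 2 then q
     else if q = 2 then if a = 3 * R then 3 else 0
     else if q < 4 + R then
       if a = 3 * R + 1 then 1 else if 4 \<le> q \<and> a = 3 * (q - 4) + 2 then 0 else q
     else case prog (q - (4 + R)) of
       Do (Inc r) p \<Rightarrow> if a = 3 * r then 4 + R + p else 0
     | Do (Dec r) p \<Rightarrow> if a = 3 * r + 1 then 4 + R + p else 0
     | _ \<Rightarrow> 0)"

text \<open>The internal loop keeps control states from being deadlocked when an operation is
  disabled.\<close>

fun line_moves :: "nat \<Rightarrow> nat \<Rightarrow> instr \<Rightarrow> (nat \<times> label \<times> nat) set" where
  "line_moves R p (Do (Test r) q) =
    {(4 + R + p, Tau, 4 + R + p), (4 + R + p, Send (3 * r + 2), 4 + R + q)}"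
| "line_moves R p (Do _ q) = {(4 + R + p, Tau, 4 + R + p)}"
| "line_moves R p (Goto Q) =
    insert (4 + R + p, Tau, 4 + R + p) ((\<lambda>q. (4 + R + p, Tau, 4 + R + q)) ` Q)"

definition moves :: "nat \<Rightarrow> (nat \<Rightarrow> instr) \<Rightarrow> nat \<Rightarrow> (nat \<times> label \<times> nat) set" where
  "moves R prog t = {(0, Tau, 0), (4 + R, Send (3 * R + 1), 1)} \<union>
    (\<Union>r<R. {(3, Send (3 * r), 4 + r), (4 + r, Send (3 * r + 1), 3)}) \<union>
    (\<Union>p\<le>t. line_moves R p (prog p))"

definition receptions :: "nat \<Rightarrow> (nat \<Rightarrow> instr) \<Rightarrow> nat \<Rightarrow> (nat \<times> label \<times> nat) set" where
  "receptions R prog t =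
    (\<lambda>(q, a). (q, Receive a, receive R prog a q)) ` ({..<5 + R + t} \<times> {..<3 * R + 2})"

text \<open>The start transition is kept apart from \<open>moves\<close> and
  \<open>receptions\<close> because its target depends on \<open>t\<close>; the other two sets only
  grow when a line is added.\<close>

definition machine_template :: "nat \<Rightarrow> (nat \<Rightarrow> instr) \<Rightarrow> nat \<Rightarrow> template" where
  "machine_template R prog t = \<lparr>num_states = 5 + R + t, init_state = 2,
     sync_actions = {..<3 * R + 2},
     delta = insert (2, Send (3 * R), 4 + R + t) (moves R prog t \<union> receptions R prog t)\<rparr>"

lemma machine_template_sel [simp]:
  "num_states (machine_template R prog t) = 5 + R + t"
  "init_state (machine_template R prog t) = 2"
  "sync_actions (machine_template R prog t) = {..<3 * R + 2}"
  "states (machine_template R prog t) = {..<5 + R + t}"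
  by (simp_all add: machine_template_def states_def)

locale counter_machine =
  fixes R t :: nat and prog :: "nat \<Rightarrow> instr"
  assumes valid: "p \<le> t \<Longrightarrow> valid_instr R t (prog p)"
begin

abbreviation N :: nat where "N \<equiv> 5 + R + t"

abbreviation B :: template where "B \<equiv> machine_template R prog t"

abbreviation u :: "nat \<Rightarrow> nat vec" where "u \<equiv> unit_vec N"

abbreviation push :: "nat \<Rightarrow> nat vec \<Rightarrow> nat vec" where "push a v \<equiv> broadcast_matrix B a *\<^sub>v v"

section \<open>Transitions of the simulating template\<close>

lemma Tau_delta_iff:
  "(i, Tau, j) \<in> delta B \<longleftrightarrow> i = 0 \<and> j = 0 \<or> (\<exists>p\<le>t. i = 4 + R + p \<and> j = i) \<or>
    (\<exists>p\<le>t. \<exists>Q q. prog p = Goto Q \<and> q \<in> Q \<and> i = 4 + R + p \<and> j = 4 + R + q)"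
proof -
  have "(i, Tau, j) \<in> line_moves R p I \<longleftrightarrow> i = 4 + R + p \<and> j = i \<or>
      (\<exists>Q q. I = Goto Q \<and> q \<in> Q \<and> i = 4 + R + p \<and> j = 4 + R + q)" for p I
    by (cases "(R, p, I)" rule: line_moves.cases) auto
  then show ?thesis
    by (auto simp: machine_template_def moves_def receptions_def)
qed

lemma Send_delta_iff:
  "(i, Send a, j) \<in> delta B \<longleftrightarrow>
    i = 2 \<and> a = 3 * R \<and> j = 4 + R + t \<or>
    i = 4 + R \<and> a = 3 * R + 1 \<and> j = 1 \<or>
    (\<exists>r<R. i = 3 \<and> a = 3 * r \<and> j = 4 + r) \<or>
    (\<exists>r<R. i = 4 + r \<and> a = 3 * r + 1 \<and> j = 3) \<or>
    (\<exists>p\<le>t. \<exists>r q. prog p = Do (Test r) q \<and> i = 4 + R + p \<and> a = 3 * r + 2 \<and> j = 4 + R + q)"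
proof -
  have "(i, Send a, j) \<in> line_moves R p I \<longleftrightarrow>
      (\<exists>r q. I = Do (Test r) q \<and> i = 4 + R + p \<and> a = 3 * r + 2 \<and> j = 4 + R + q)" for p I
    by (cases "(R, p, I)" rule: line_moves.cases) auto
  then show ?thesis
    by (auto simp: machine_template_def moves_def receptions_def)
qed

lemma Receive_delta_iff:
  "(i, Receive a, j) \<in> delta B \<longleftrightarrow> i < N \<and> a < 3 * R + 2 \<and> j = receive R prog a i"
proof -
  have "(i, Receive a, j) \<notin> line_moves R p I" for p I
    by (cases "(R, p, I)" rule: line_moves.cases) auto
  then show ?thesis
    by (auto simp: machine_template_def moves_def receptions_def)
qed

lemma receive_less:
  assumes "q < N"
  shows "receive R prog a q < N"
proof (cases "q < 4 + R")
  case True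
  then show ?thesis by (auto simp: receive_def)
next
  case False
  then have "valid_instr R t (prog (q - (4 + R)))" using assms by (intro valid) simp
  then show ?thesis using False
    by (auto simp: receive_def split: instr.split operation.split)
qed

lemma valid_Test: "prog p = Do (Test r) q \<Longrightarrow> p \<le> t \<Longrightarrow> r < R \<and> q \<le> t"
  using valid[of p] by simp

lemma valid_Goto: "prog p = Goto Q \<Longrightarrow> p \<le> t \<Longrightarrow> q \<in> Q \<Longrightarrow> q \<le> t"
  using valid[of p] by auto

lemma broadcast_template_machine: "broadcast_template B"
proof -
  have "(i, l, j) \<in> states B \<times> alphabet B \<times> states B" if "(i, l, j) \<in> delta B" for i l j
  proof (cases l)
    case Tau
    with that show ?thesis
      by (auto simp: Tau_delta_iff alphabet_def dest: valid_Goto)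
  next
    case (Send a)
    with that show ?thesis
      by (auto simp: Send_delta_iff alphabet_def dest: valid_Test)
  next
    case (Receive a)
    with that show ?thesis
      using receive_less by (auto simp: Receive_delta_iff alphabet_def)
  qed
  then have "delta B \<subseteq> states B \<times> alphabet B \<times> states B" by auto
  then show ?thesis
    by (auto simp: broadcast_template_def Receive_delta_iff)
qed

section \<open>Broadcasts acting on counter vectors\<close>

lemma push_carrier [simp]: "push a v \<in> carrier_vec N"
  by (intro carrier_vecI) (simp add: broadcast_matrix_def)

lemma push_index:
  assumes "a < 3 * R + 2" "v \<in> carrier_vec N" "j < N"
  shows "push a v $ j = (\<Sum>i<N. if receive R prog a i = j then v $ i else 0)"
proof -
  have "push a v $ j = (\<Sum>i<N. (if (i, Receive a, j) \<in> delta B then 1 else 0) * v $ i)"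
    using assms
    by (simp add: broadcast_matrix_def mult_mat_vec_def scalar_prod_def row_def lessThan_atLeast0)
  also have "\<dots> = (\<Sum>i<N. if receive R prog a i = j then v $ i else 0)"
    using assms(1) by (intro sum.cong) (auto simp: Receive_delta_iff)
  finally show ?thesis .
qed

text \<open>The processes in \<open>i\<close> are among those that arrive in the state to which
  \<open>i\<close> is sent. This lower bound suffices to show that the trap is occupied.\<close>

lemma push_ge:
  assumes "a < 3 * R + 2" "v \<in> carrier_vec N" "i < N"
  shows "v $ i \<le> push a v $ receive R prog a i"
proof -
  let ?j = "receive R prog a i"
  have "(if receive R prog a i = ?j then v $ i else 0) \<le>
      (\<Sum>i<N. if receive R prog a i = ?j then v $ i else 0)"
    using assms by (intro member_le_sum) auto
  then show ?thesis using assms receive_less by (simp add: push_index)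
qed

lemma push_eq_0:
  assumes "a < 3 * R + 2" "v \<in> carrier_vec N" "j < N"
    and "\<And>i. i < N \<Longrightarrow> v $ i \<noteq> 0 \<Longrightarrow> receive R prog a i \<noteq> j"
  shows "push a v $ j = 0"
  unfolding push_index[OF assms(1-3)] using assms(4) by (intro sum.neutral) auto

lemma push_fixed:
  assumes "a < 3 * R + 2" "v \<in> carrier_vec N"
    and "\<And>i. i < N \<Longrightarrow> v $ i \<noteq> 0 \<Longrightarrow> receive R prog a i = i"
  shows "push a v = v"
proof (rule eq_vecI)
  fix j assume j: "j < dim_vec v"
  then have "push a v $ j = (\<Sum>i<N. if receive R prog a i = j then v $ i else 0)"
    using assms by (intro push_index) auto
  also have "\<dots> = (\<Sum>i<N. if i = j then v $ j else 0)"
  proof (intro sum.cong refl)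
    fix i assume "i \<in> {..<N}"
    then show "(if receive R prog a i = j then v $ i else 0) = (if i = j then v $ j else 0)"
      using assms(3)[of i] by (cases "v $ i = 0") auto
  qed
  also have "\<dots> = v $ j" using j assms(2) by simp
  finally show "push a v $ j = v $ j" .
qed (use assms(2) in \<open>simp add: broadcast_matrix_def\<close>)

lemma push_unit:
  assumes "a < 3 * R + 2" "i < N"
  shows "push a (u i) = u (receive R prog a i)"
proof (rule eq_vecI)
  fix j assume "j < dim_vec (u (receive R prog a i))"
  then have "push a (u i) $ j = (\<Sum>k<N. if receive R prog a k = j then u i $ k else 0)"
    using assms by (intro push_index) auto
  also have "\<dots> = (\<Sum>k<N. if k = i then if receive R prog a i = j then 1 else 0 else 0)"
    using assms by (intro sum.cong) (auto simp: unit_vec_def)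
  finally show "push a (u i) $ j = u (receive R prog a i) $ j"
    using assms receive_less \<open>j < _\<close> by (simp add: unit_vec_def)
qed (simp add: broadcast_matrix_def)

lemma push_add:
  assumes "v \<in> carrier_vec N" "w \<in> carrier_vec N"
  shows "push a (v + w) = push a v + push a w"
  using assms by (intro mult_add_distrib_mat_vec[of _ N N]) (auto simp: broadcast_matrix_def)

section \<open>Vectors that represent machine configurations\<close>

definition pool :: "store \<Rightarrow> nat \<Rightarrow> nat vec" where
  "pool s m = vec N (\<lambda>q. if q = 3 then m else if 4 \<le> q \<and> q < 4 + R then s (q - 4) else 0)"

text \<open>There is a single control process, and the \<open>m\<close> idle processes are the
  reserve for later increments. The trap, the dead state and the initial state are empty.\<close>

definition conf :: "nat \<Rightarrow> store \<Rightarrow> nat \<Rightarrow> nat vec" where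
  "conf p s m = pool s m + u (4 + R + p)"

lemma pool_carrier [simp]: "pool s m \<in> carrier_vec N" "dim_vec (pool s m) = N"
  by (simp_all add: pool_def)

lemma conf_carrier [simp]: "conf p s m \<in> carrier_vec N" "dim_vec (conf p s m) = N"
  by (simp_all add: conf_def)

lemma conf_index:
  "q < N \<Longrightarrow> conf p s m $ q = (if q = 3 then m else if 4 \<le> q \<and> q < 4 + R then s (q - 4)
     else if q = 4 + R + p then 1 else 0)"
  by (auto simp: conf_def pool_def unit_vec_def)

text \<open>Below \<open>3 * R\<close>, only the test of a register moves any process of the pool,
  and it moves just the units of that register, of which there are none by assumption.\<close>

lemma push_pool:
  assumes "a < 3 * R" and "\<And>r. a = 3 * r + 2 \<Longrightarrow> s r = 0"
  shows "push a (pool s m) = pool s m"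
  using assms by (intro push_fixed) (auto simp: pool_def receive_def split: if_splits)

lemma push_conf:
  assumes "a < 3 * R" "p \<le> t" and "\<And>r. a = 3 * r + 2 \<Longrightarrow> s r = 0"
  shows "push a (conf p s m) = pool s m + u (receive R prog a (4 + R + p))"
proof -
  have "push a (pool s m) = pool s m"
    using assms by (intro push_pool)
  moreover have "push a (u (4 + R + p)) = u (receive R prog a (4 + R + p))"
    using assms by (intro push_unit) auto
  ultimately show ?thesis by (simp add: conf_def push_add)
qed

lemma push_conf_Inc:
  "r < R \<Longrightarrow> p \<le> t \<Longrightarrow>
    push (3 * r) (conf p s m) = pool s m + u (receive R prog (3 * r) (4 + R + p))"
  by (intro push_conf) (simp, simp, presburger)

lemma push_conf_Dec:
  "r < R \<Longrightarrow> p \<le> t \<Longrightarrow>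
    push (3 * r + 1) (conf p s m) = pool s m + u (receive R prog (3 * r + 1) (4 + R + p))"
  by (intro push_conf) (simp, simp, presburger)

section \<open>Machine steps and transitions of the counter system\<close>

lemma bc_transI_Tau:
  assumes "(i, Tau, j) \<in> delta B" "c \<in> carrier_vec N" "c $ i \<ge> 1"
  shows "(c, c - u i + u j) \<in> bc_trans B"
  using assms by (auto simp: bc_trans_def bc_states_def Let_def)

lemma bc_transI_Send:
  assumes "(i, Send a, j) \<in> delta B" "a < 3 * R + 2" "c \<in> carrier_vec N" "c $ i \<ge> 1"
  shows "(c, push a (c - u i) + u j) \<in> bc_trans B"
  using assms by (simp add: bc_trans_def bc_states_def Let_def) blast

lemma bc_transE:
  assumes "(c, c') \<in> bc_trans B"
  obtains i j where "(i, Tau, j) \<in> delta B" "c \<in> carrier_vec N" "c $ i \<ge> 1" "c' = c - u i + u j"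
  | i a j where "(i, Send a, j) \<in> delta B" "a < 3 * R + 2" "c \<in> carrier_vec N" "c $ i \<ge> 1"
      "c' = push a (c - u i) + u j"
  using assms by (auto simp: bc_trans_def bc_states_def Let_def)

lemma conf_move: "p \<le> t \<Longrightarrow> conf p s m - u (4 + R + p) + u (4 + R + q) = conf q s m"
  by (rule eq_vecI) (auto simp: conf_index conf_def pool_def unit_vec_def)

lemma conf_minus_control: "p \<le> t \<Longrightarrow> conf p s m - u (4 + R + p) = pool s m"
  by (rule eq_vecI) (auto simp: conf_def pool_def unit_vec_def)

lemma conf_minus_idle: "conf p s (Suc m) - u 3 = conf p s m"
  by (rule eq_vecI) (auto simp: conf_index)

lemma conf_minus_register:
  "r < R \<Longrightarrow> 0 < s r \<Longrightarrow> conf p s m - u (4 + r) = conf p (s(r := s r - 1)) m"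
  by (rule eq_vecI) (auto simp: conf_index)

lemma pool_plus_register: "r < R \<Longrightarrow> pool s m + u q + u (4 + r) = pool (s(r := Suc (s r))) m + u q"
  by (rule eq_vecI) (auto simp: pool_def)

lemma pool_plus_idle: "pool s m + u q + u 3 = pool s (Suc m) + u q"
  by (rule eq_vecI) (auto simp: pool_def)

text \<open>One transition simulates one machine step. An increment takes one process from the
  reserve, which is therefore assumed to be \<open>Suc m\<close>; a decrement returns one.\<close>

lemma step_bc_trans:
  assumes "step prog (p, s) (q, s')" "p \<le> t"
  shows "q \<le> t \<and> (\<exists>m'\<ge>m. (conf p s (Suc m), conf q s' m') \<in> bc_trans B)"
  using assms(1)
proof cases
  case (Do a)
  have q: "q \<le> t" and r: "register a < R" using valid[OF assms(2)] Do by auto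
  show ?thesis
  proof (cases a)
    case (Inc r)
    have "push (3 * r) (conf p s m) = pool s m + u (4 + R + q)"
      using r Do Inc assms(2) push_conf_Inc[of r p s m] by (simp add: receive_def)
    then have "push (3 * r) (conf p s (Suc m) - u 3) + u (4 + r) = conf q s' m"
      using r Do Inc by (simp add: conf_minus_idle pool_plus_register conf_def[of q])
    moreover have "(conf p s (Suc m), push (3 * r) (conf p s (Suc m) - u 3) + u (4 + r)) \<in> bc_trans B"
      using r Inc by (intro bc_transI_Send) (auto simp: Send_delta_iff conf_index)
    ultimately show ?thesis using q by auto
  next
    case (Dec r)
    have "push (3 * r + 1) (conf p s' (Suc m)) = pool s' (Suc m) + u (4 + R + q)"
      using r Do Dec assms(2) push_conf_Dec[of r p s' "Suc m"] by (simp add: receive_def)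
    moreover have "conf p s (Suc m) - u (4 + r) = conf p s' (Suc m)"
      using r Do Dec by (simp add: conf_minus_register)
    ultimately have "push (3 * r + 1) (conf p s (Suc m) - u (4 + r)) + u 3 = conf q s' (Suc (Suc m))"
      by (simp add: pool_plus_idle conf_def[of q])
    moreover have "(conf p s (Suc m), push (3 * r + 1) (conf p s (Suc m) - u (4 + r)) + u 3)
        \<in> bc_trans B"
      using r Do Dec by (intro bc_transI_Send) (auto simp: Send_delta_iff conf_index)
    ultimately show ?thesis using q by (intro conjI exI[of _ "Suc (Suc m)"]) auto
  next
    case (Test r)
    have "push (3 * r + 2) (conf p s (Suc m) - u (4 + R + p)) + u (4 + R + q) = conf q s' (Suc m)"
      using r Do Test assms(2) push_pool[of "3 * r + 2" s "Suc m"]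
      by (simp add: conf_minus_control conf_def[of q])
    moreover have "(conf p s (Suc m), push (3 * r + 2) (conf p s (Suc m) - u (4 + R + p)) + u (4 + R + q))
        \<in> bc_trans B"
      using r Do Test assms(2) by (intro bc_transI_Send) (auto simp: Send_delta_iff conf_index)
    ultimately show ?thesis using q by (intro conjI exI[of _ "Suc m"]) auto
  qed
next
  case (Goto Q)
  have "q \<le> t" using valid_Goto Goto assms(2) by blast
  moreover have "(conf p s (Suc m), conf p s (Suc m) - u (4 + R + p) + u (4 + R + q)) \<in> bc_trans B"
    using Goto assms(2) by (intro bc_transI_Tau) (auto simp: Tau_delta_iff conf_index)
  ultimately show ?thesis
    using Goto assms(2) by (intro conjI exI[of _ "Suc m"]) (simp_all add: conf_move)
qed

text \<open>A broadcast either agrees with the current instruction, and the machine makes the same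
  step, or it sends control or a unit of a tested register to the trap. The internal loop of control
  is covered by zero machine steps, and \<open>p \<noteq> 0\<close> excludes the halt
  broadcast.\<close>

lemma conf_bc_trans:
  assumes "(conf p s m, c') \<in> bc_trans B" "p \<le> t" "p \<noteq> 0"
  shows "c' $ 0 \<ge> 1 \<or> (\<exists>q s' m'. q \<le> t \<and> c' = conf q s' m' \<and> (step prog)\<^sup>*\<^sup>* (p, s) (q, s'))"
  using assms(1)
proof (cases rule: bc_transE)
  case (1 i j)
  from 1(1) consider "i = 0" | p' where "p' \<le> t" "i = 4 + R + p'" "j = i"
    | p' Q q where "p' \<le> t" "prog p' = Goto Q" "q \<in> Q" "i = 4 + R + p'" "j = 4 + R + q"
    by (auto simp: Tau_delta_iff)
  then show ?thesis
  proof cases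
    case 1
    then show ?thesis using \<open>1 \<le> conf p s m $ i\<close> by (simp add: conf_index)
  next
    case 2
    then have "p' = p" using \<open>1 \<le> conf p s m $ i\<close> by (simp add: conf_index split: if_splits)
    then have "c' = conf p s m" using 1(4) 2 assms(2) by (simp add: conf_move)
    then show ?thesis using assms(2) by blast
  next
    case 3
    then have "p' = p" using \<open>1 \<le> conf p s m $ i\<close> by (simp add: conf_index split: if_splits)
    then have "c' = conf q s m" using 1(4) 3 assms(2) by (simp add: conf_move)
    moreover have "step prog (p, s) (q, s)" using 3 \<open>p' = p\<close> by (auto intro: step.Goto)
    moreover have "q \<le> t" using valid_Goto 3 by blast
    ultimately show ?thesis by blast
  qed
next
  case (2 i a j)
  from 2(1) consider "i = 2" | "i = 4 + R + 0"
    | r where "r < R" "i = 3" "a = 3 * r" "j = 4 + r"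
    | r where "r < R" "i = 4 + r" "a = 3 * r + 1" "j = 3"
    | p' r q where "p' \<le> t" "prog p' = Do (Test r) q" "i = 4 + R + p'" "a = 3 * r + 2"
        "j = 4 + R + q"
    by (auto simp: Send_delta_iff)
  then show ?thesis
  proof cases
    case 1
    then show ?thesis using 2(4) by (simp add: conf_index)
  next
    case 2
    then show ?thesis using \<open>1 \<le> conf p s m $ i\<close> assms(3) by (simp add: conf_index)
  next
    case 3
    then obtain l where l: "m = Suc l" using 2(4) by (cases m) (auto simp: conf_index)
    have c': "c' = pool s l + u (receive R prog (3 * r) (4 + R + p)) + u (4 + r)"
      using 2(5) 3 assms(2) push_conf_Inc[of r p s l] by (simp add: l conf_minus_idle)
    show ?thesis
    proof (cases "\<exists>q. prog p = Do (Inc r) q")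
      case True
      then obtain q where q: "prog p = Do (Inc r) q" ..
      then have "c' = conf q (s(r := Suc (s r))) l"
        using 3 by (simp add: c' receive_def pool_plus_register conf_def)
      moreover have "step prog (p, s) (q, s(r := Suc (s r)))" using q by (auto intro: step.Do)
      moreover have "q \<le> t" using valid[OF assms(2)] q by simp
      ultimately show ?thesis by blast
    next
      case False
      \<comment> \<open>Control at any other instruction, an increment of another register included,
        falls into the trap.\<close>
      then have "receive R prog (3 * r) (4 + R + p) = 0"
        by (auto simp: receive_def split: instr.split operation.split) presburger+
      then show ?thesis by (simp add: c' pool_def)
    qed
  next
    case 4
    then have pos: "0 < s r" using 2(4) by (auto simp: conf_index)
    have c': "c' = pool (s(r := s r - 1)) m + u (receive R prog (3 * r + 1) (4 + R + p)) + u 3"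
      using 2(5) 4 pos assms(2) push_conf_Dec[of r p "s(r := s r - 1)" m]
      by (simp add: conf_minus_register)
    show ?thesis
    proof (cases "\<exists>q. prog p = Do (Dec r) q")
      case True
      then obtain q where q: "prog p = Do (Dec r) q" ..
      then have "c' = conf q (s(r := s r - 1)) (Suc m)"
        by (simp add: c' receive_def pool_plus_idle conf_def)
      moreover have "step prog (p, s) (q, s(r := s r - 1))" using q pos by (auto intro: step.Do)
      moreover have "q \<le> t" using valid[OF assms(2)] q by simp
      ultimately show ?thesis by blast
    next
      case False
      then have "receive R prog (3 * r + 1) (4 + R + p) = 0"
        by (auto simp: receive_def split: instr.split operation.split) presburger+
      then show ?thesis by (simp add: c' pool_def)
    qed
  next
    case 5
    then have p': "p' = p" using 2(4) by (simp add: conf_index split: if_splits)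
    then have r: "r < R" and q: "q \<le> t" using valid_Test 5 by blast+
    have c': "c' = push a (pool s m) + u (4 + R + q)"
      using 2(5) 5 p' assms(2) by (simp add: conf_minus_control)
    show ?thesis
    proof (cases "s r = 0")
      case True
      then have "c' = conf q s m" using c' 5 r push_pool[of "3 * r + 2" s m] by (simp add: conf_def)
      moreover have "step prog (p, s) (q, s)" using 5 p' True by (auto intro: step.Do)
      ultimately show ?thesis using q by blast
    next
      case False
      \<comment> \<open>The zero test can be broadcast although the register is positive, but then
        its units are trapped.\<close>
      have "pool s m $ (4 + r) \<le> push a (pool s m) $ receive R prog a (4 + r)"
        using r 5 by (intro push_ge) auto
      moreover have "receive R prog a (4 + r) = 0" using 5 r by (simp add: receive_def)
      moreover have "pool s m $ (4 + r) = s r" using r by (simp add: pool_def)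
      ultimately have "c' $ 0 \<ge> 1" using False by (simp add: c')
      then show ?thesis ..
    qed
  qed
qed

text \<open>The only internal move of the trap is its loop, it sends nothing, and every reception
  keeps its processes there.\<close>

lemma trap_bc_trans:
  assumes "(c, c') \<in> bc_trans B" "c $ 0 \<ge> 1"
  shows "c' $ 0 \<ge> 1"
  using assms(1)
proof (cases rule: bc_transE)
  case (1 i j)
  then show ?thesis using assms(2) by (auto simp: Tau_delta_iff)
next
  case (2 i a j)
  then have "i \<noteq> 0" by (auto simp: Send_delta_iff)
  then have "(c - u i) $ 0 \<ge> 1" using assms(2) 2 by (simp add: unit_vec_def)
  moreover have "(c - u i) $ 0 \<le> push a (c - u i) $ receive R prog a 0"
    using 2 by (intro push_ge) auto
  moreover have "receive R prog a 0 = 0" by (simp add: receive_def)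
  ultimately show ?thesis using 2 by simp
qed

section \<open>Initial vectors, start and halt broadcasts\<close>

definition start :: "nat \<Rightarrow> nat vec" where
  "start k = vec N (\<lambda>q. if q = 2 then k else 0)"

lemma start_carrier [simp]: "start k \<in> carrier_vec N" "dim_vec (start k) = N"
  by (simp_all add: start_def)

lemma bc_initial_iff: "c \<in> bc_initial B \<longleftrightarrow> (\<exists>k. c = start (Suc k))"
proof
  assume c: "c \<in> bc_initial B"
  then have "c $ 2 \<noteq> 0" by (simp add: bc_initial_def)
  then obtain k where "c $ 2 = Suc k" using not0_implies_Suc by blast
  then have "c = start (Suc k)"
    using c by (intro eq_vecI) (auto simp: bc_initial_def bc_states_def start_def)
  then show "\<exists>k. c = start (Suc k)" ..
qed (auto simp: bc_initial_def bc_states_def start_def)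

lemma push_start: "push (3 * R) (start k) = pool (\<lambda>_. 0) k"
proof (rule eq_vecI)
  fix j assume "j < dim_vec (pool (\<lambda>_. 0) k)"
  then have j: "j < N" by simp
  have "push (3 * R) (start k) $ j = (\<Sum>i<N. if receive R prog (3 * R) i = j then start k $ i else 0)"
    using j by (intro push_index) auto
  also have "\<dots> = (\<Sum>i<N. if i = 2 then if j = 3 then k else 0 else 0)"
    by (intro sum.cong) (auto simp: start_def receive_def)
  finally show "push (3 * R) (start k) $ j = pool (\<lambda>_. 0) k $ j"
    using j by (simp add: pool_def)
qed (simp add: broadcast_matrix_def)

lemma start_minus: "start (Suc k) - u 2 = start k"
  by (rule eq_vecI) (auto simp: start_def)

text \<open>Initially the start broadcast is the only enabled transition: its sender becomes
  control, and the other \<open>k\<close> processes become the reserve, so the number of processes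
  bounds the available memory.\<close>

lemma start_bc_trans_iff: "(start (Suc k), c') \<in> bc_trans B \<longleftrightarrow> c' = conf t (\<lambda>_. 0) k"
proof
  assume "(start (Suc k), c') \<in> bc_trans B"
  then show "c' = conf t (\<lambda>_. 0) k"
  proof (cases rule: bc_transE)
    case (1 i j)
    then show ?thesis by (auto simp: Tau_delta_iff start_def)
  next
    case (2 i a j)
    then have "i = 2" "a = 3 * R" "j = 4 + R + t"
      by (auto simp: Send_delta_iff start_def)
    then show ?thesis using 2 by (simp add: start_minus push_start conf_def)
  qed
next
  have "(start (Suc k), push (3 * R) (start (Suc k) - u 2) + u (4 + R + t)) \<in> bc_trans B"
    by (intro bc_transI_Send) (auto simp: Send_delta_iff start_def)
  then show "c' = conf t (\<lambda>_. 0) k \<Longrightarrow> (start (Suc k), c') \<in> bc_trans B"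
    by (simp add: start_minus push_start conf_def)
qed

text \<open>The halt broadcast gathers all processes in state 1, which has no internal or sending
  transition.\<close>

lemma halting_conf_deadlock: "\<exists>d. (conf 0 s m, d) \<in> bc_trans B \<and> (\<forall>e. (d, e) \<notin> bc_trans B)"
proof -
  let ?a = "3 * R + 1"
  let ?d = "push ?a (conf 0 s m - u (4 + R + 0)) + u 1"
  have "(conf 0 s m, ?d) \<in> bc_trans B"
    by (intro bc_transI_Send) (auto simp: Send_delta_iff conf_index)
  moreover have "?d $ q = 0" if "q < N" "q \<noteq> 1" for q
  proof -
    have "push ?a (pool s m) $ q = 0"
      using that by (intro push_eq_0) (auto simp: pool_def receive_def split: if_splits)
    then show ?thesis using that by (simp only: conf_minus_control) simp
  qed
  then have "(?d, e) \<notin> bc_trans B" for e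
  proof (intro notI)
    assume zero: "\<And>q. q < N \<Longrightarrow> q \<noteq> 1 \<Longrightarrow> ?d $ q = 0" and "(?d, e) \<in> bc_trans B"
    from this(2) show False
    proof (cases rule: bc_transE)
      case (1 i j)
      then have "i < N" "i \<noteq> 1" by (auto simp: Tau_delta_iff)
      then show False using zero 1(3) by simp
    next
      case (2 i a j)
      then have "i < N" "i \<noteq> 1" by (auto simp: Send_delta_iff)
      then show False using zero 2(4) by simp
    qed
  qed
  ultimately show ?thesis by blast
qed

text \<open>Each step costs at most one idle process, so a reserve as large as the number of steps
  suffices. The claim covers all larger reserves because the reserve left after a step is known only
  by a lower bound.\<close>

lemma steps_bc_trans:
  assumes "(step prog)\<^sup>*\<^sup>* (p, s) (q, s')" "p \<le> t"
  shows "\<exists>k. \<forall>m\<ge>k. \<exists>m'. (conf p s m, conf q s' m') \<in> (bc_trans B)\<^sup>*"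
  using assms
proof (induction "(p, s)" arbitrary: p s rule: converse_rtranclp_induct)
  case base
  then show ?case by blast
next
  case (step y)
  obtain p' v where y: "y = (p', v)" by (cases y)
  note sim = step_bc_trans[OF step.hyps(1)[unfolded y] step.prems]
  then have "p' \<le> t" ..
  from step.hyps(3)[OF y this]
  obtain k where k: "\<forall>m\<ge>k. \<exists>m'. (conf p' v m, conf q s' m') \<in> (bc_trans B)\<^sup>*" ..
  have "\<exists>m'. (conf p s m, conf q s' m') \<in> (bc_trans B)\<^sup>*" if "m \<ge> Suc k" for m
  proof -
    from Suc_le_D[OF that] obtain l where l: "m = Suc l" ..
    from sim[of l] l obtain m' where m': "m' \<ge> l" "(conf p s m, conf p' v m') \<in> bc_trans B"
      by auto
    have "k \<le> m'" using that l m'(1) by simp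
    with k obtain m'' where "(conf p' v m', conf q s' m'') \<in> (bc_trans B)\<^sup>*" by auto
    with m'(2) have "(conf p s m, conf q s' m'') \<in> (bc_trans B)\<^sup>*"
      by (rule converse_rtrancl_into_rtrancl)
    then show ?thesis ..
  qed
  then show ?case by blast
qed

lemma has_deadlocked_run_start_iff:
  "has_deadlocked_run B \<longleftrightarrow>
    (\<exists>k d. (start (Suc k), d) \<in> (bc_trans B)\<^sup>* \<and> (\<forall>e. (d, e) \<notin> bc_trans B))"
proof -
  have "(\<exists>c\<in>bc_initial B. P c) \<longleftrightarrow> (\<exists>k. P (start (Suc k)))" for P
    unfolding Bex_def bc_initial_iff by auto
  then show ?thesis by (simp only: has_deadlocked_run_iff)
qed

theorem has_deadlocked_run_machine_iff: "has_deadlocked_run B \<longleftrightarrow> halts prog t (\<lambda>_. 0)"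
proof
  assume "halts prog t (\<lambda>_. 0)"
  then obtain s' where "(step prog)\<^sup>*\<^sup>* (t, \<lambda>_. 0) (0, s')" by (auto simp: halts_def)
  then obtain k m' where run: "(conf t (\<lambda>_. 0) k, conf 0 s' m') \<in> (bc_trans B)\<^sup>*"
    using steps_bc_trans by blast
  obtain d where d: "(conf 0 s' m', d) \<in> bc_trans B" "\<forall>e. (d, e) \<notin> bc_trans B"
    using halting_conf_deadlock by blast
  have "(start (Suc k), conf t (\<lambda>_. 0) k) \<in> bc_trans B"
    by (simp add: start_bc_trans_iff)
  also note run
  also note d(1)
  finally have "(start (Suc k), d) \<in> (bc_trans B)\<^sup>*" .
  with d(2) show "has_deadlocked_run B"
    unfolding has_deadlocked_run_start_iff by (intro exI conjI)
next
  assume "has_deadlocked_run B"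
  then obtain k d where d: "(start (Suc k), d) \<in> (bc_trans B)\<^sup>*" "\<forall>e. (d, e) \<notin> bc_trans B"
    unfolding has_deadlocked_run_start_iff by (elim exE conjE) (rule that)
  show "halts prog t (\<lambda>_. 0)"
  proof (rule ccontr)
    assume not_halts: "\<not> halts prog t (\<lambda>_. 0)"
    define reach where "reach = (\<lambda>p s. p \<le> t \<and> (step prog)\<^sup>*\<^sup>* (t, \<lambda>_. 0) (p, s))"
    have nonzero: "p \<noteq> 0" if "reach p s" for p s
      using that not_halts by (cases "p = 0") (auto simp: reach_def halts_def)
    \<comment> \<open>The invariant if the machine does not halt: the vector is initial, or the trap
      is occupied, or it represents a reachable machine configuration. Each of these has a
      successor.\<close>
    from d(1) have "d \<in> carrier_vec N \<and>
        (d = start (Suc k) \<or> d $ 0 \<ge> 1 \<or> (\<exists>p s m. reach p s \<and> d = conf p s m))"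
    proof (induction rule: rtrancl_induct)
      case base
      then show ?case by simp
    next
      case (step d e)
      have e: "e \<in> carrier_vec N"
        using bc_trans_in_states[OF step.hyps(2)] by (simp add: bc_states_def)
      from step.IH consider "d = start (Suc k)" | "d $ 0 \<ge> 1"
        | p s m where "reach p s" "d = conf p s m" by blast
      then show ?case
      proof cases
        case 1
        then have "e = conf t (\<lambda>_. 0) k" using step.hyps(2) by (simp add: start_bc_trans_iff)
        moreover have "reach t (\<lambda>_. 0)" by (simp add: reach_def)
        ultimately show ?thesis using e by blast
      next
        case 2
        then show ?thesis using trap_bc_trans[OF step.hyps(2)] e by blast
      next
        case 3
        then have "(conf p s m, e) \<in> bc_trans B" "p \<le> t" "p \<noteq> 0"
          using step.hyps(2) nonzero by (auto simp: reach_def)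
        from conf_bc_trans[OF this] consider "e $ 0 \<ge> 1"
          | q s' m' where "q \<le> t" "e = conf q s' m'" "(step prog)\<^sup>*\<^sup>* (p, s) (q, s')" by blast
        then show ?thesis
        proof cases
          case 1
          then show ?thesis using e by blast
        next
          case 2
          then have "reach q s'" using 3(1) by (auto simp: reach_def)
          then show ?thesis using 2(2) e by blast
        qed
      qed
    qed
    then consider "d = start (Suc k)" | "d $ 0 \<ge> 1" "d \<in> carrier_vec N"
      | p s m where "reach p s" "d = conf p s m" by blast
    then show False
    proof cases
      case 1
      then show False using d(2) by (simp add: start_bc_trans_iff)
    next
      case 2
      then show False using d(2) bc_transI_Tau[of 0 0 d] by (auto simp: Tau_delta_iff)
    next
      case 3
      then have "p \<le> t" by (simp add: reach_def)
      \<comment> \<open>This is the internal loop of control, which is enabled even if the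
        instruction is not.\<close>
      then have "(d, d - u (4 + R + p) + u (4 + R + p)) \<in> bc_trans B"
        using 3 by (intro bc_transI_Tau) (auto simp: Tau_delta_iff conf_index)
      then show False using d(2) by blast
    qed
  qed
qed

end


section \<open>Total recursive functions\<close>

definition total_rec :: "nat \<Rightarrow> (nat list \<Rightarrow> nat) \<Rightarrow> bool" where
  "total_rec k f \<longleftrightarrow> (\<exists>r. \<forall>xs. length xs = k \<longrightarrow> rec_eval r xs (f xs))"

lemma total_recI: "(\<And>xs. length xs = k \<Longrightarrow> rec_eval r xs (f xs)) \<Longrightarrow> total_rec k f"
  by (auto simp: total_rec_def)

lemma total_rec_cong:
  "total_rec k f \<Longrightarrow> (\<And>xs. length xs = k \<Longrightarrow> g xs = f xs) \<Longrightarrow> total_rec k g"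
  by (auto simp: total_rec_def)

lemma total_rec_nth [intro]: "i < k \<Longrightarrow> total_rec k (\<lambda>xs. xs ! i)"
  by (rule total_recI[of _ "Proj i"]) simp

lemma total_rec_comp:
  assumes "total_rec (length gs) h" "\<And>g. g \<in> set gs \<Longrightarrow> total_rec k g"
  shows "total_rec k (\<lambda>xs. h (map (\<lambda>g. g xs) gs))"
proof -
  obtain r where r: "\<And>xs. length xs = length gs \<Longrightarrow> rec_eval r xs (h xs)"
    using assms(1) by (auto simp: total_rec_def)
  have "\<forall>g. \<exists>r. g \<in> set gs \<longrightarrow> (\<forall>xs. length xs = k \<longrightarrow> rec_eval r xs (g xs))"
    using assms(2) by (auto simp: total_rec_def)
  then obtain \<rho> where \<rho>: "\<And>g xs. g \<in> set gs \<Longrightarrow> length xs = k \<Longrightarrow> rec_eval (\<rho> g) xs (g xs)"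
    by metis
  show ?thesis
  proof (rule total_recI)
    fix xs :: "nat list" assume "length xs = k"
    then have "list_all2 (\<lambda>g y. rec_eval g xs y) (map \<rho> gs) (map (\<lambda>g. g xs) gs)"
      using \<rho> by (auto simp: list_all2_map1 list_all2_map2 intro: list.rel_refl_strong)
    then show "rec_eval (Comp r (map \<rho> gs)) xs (h (map (\<lambda>g. g xs) gs))"
      using r by (auto intro: rec_eval.Comp)
  qed
qed

lemma total_rec_comp1:
  assumes "total_rec 1 (\<lambda>xs. h (xs ! 0))" "total_rec k f"
  shows "total_rec k (\<lambda>xs. h (f xs))"
  using total_rec_comp[of "[f]" "\<lambda>xs. h (xs ! 0)" k] assms by simp

lemma total_rec_tl:
  assumes "total_rec k f"
  shows "total_rec (Suc k) (\<lambda>xs. f (tl xs))"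
proof (rule total_rec_cong)
  show "total_rec (Suc k) (\<lambda>xs. f (map (\<lambda>g. g xs) (map (\<lambda>i xs. xs ! Suc i) [0..<k])))"
    using assms by (intro total_rec_comp) auto
  show "f (tl xs) = f (map (\<lambda>g. g xs) (map (\<lambda>i xs. xs ! Suc i) [0..<k]))"
    if "length xs = Suc k" for xs
    using that by (intro arg_cong[of _ _ f]) (auto intro!: nth_equalityI simp: nth_tl)
qed

lemma total_rec_Suc [intro]: "total_rec k f \<Longrightarrow> total_rec k (\<lambda>xs. Suc (f xs))"
  by (rule total_rec_comp1[of Suc], rule total_recI[of _ Succ]) (auto simp: length_Suc_conv)

lemma total_rec_const [intro]: "total_rec k (\<lambda>_. n)"
proof (induction n)
  case 0
  show ?case by (rule total_recI[of _ Zero]) simp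
qed auto

text \<open>The depth of the recursion is itself computed from \<open>xs\<close>:
  \<open>PrimRec\<close> takes it as an additional first argument, for which composition substitutes
  \<open>b xs\<close>.\<close>

lemma total_rec_rec_nat:
  assumes "total_rec k f" "total_rec (Suc (Suc k)) g" "total_rec k b"
  shows "total_rec k (\<lambda>xs. rec_nat (f xs) (\<lambda>n y. g (n # y # xs)) (b xs))"
proof -
  obtain r where r: "\<And>xs. length xs = k \<Longrightarrow> rec_eval r xs (f xs)"
    using assms(1) by (auto simp: total_rec_def)
  obtain r' where r': "\<And>xs. length xs = Suc (Suc k) \<Longrightarrow> rec_eval r' xs (g xs)"
    using assms(2) by (auto simp: total_rec_def)
  let ?h = "\<lambda>xs. rec_nat (f (tl xs)) (\<lambda>n y. g (n # y # tl xs)) (hd xs)"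
  have "rec_eval (PrimRec r r') (n # xs) (?h (n # xs))" if "length xs = k" for n xs
  proof (induction n)
    case 0
    then show ?case using that by (simp add: r)
  next
    case (Suc n)
    have "rec_eval r' (n # ?h (n # xs) # xs) (g (n # ?h (n # xs) # xs))"
      using that by (intro r') simp
    with Suc have "rec_eval (PrimRec r r') (Suc n # xs) (g (n # ?h (n # xs) # xs))"
      by (rule rec_eval.PrimRec_Suc)
    then show ?case by (simp del: rec_eval_PrimRec_Suc_iff)
  qed
  then have "total_rec (Suc k) ?h"
    by (intro total_recI[of _ "PrimRec r r'"]) (auto simp: length_Suc_conv)
  then have "total_rec k (\<lambda>xs. ?h (map (\<lambda>g. g xs) (b # map (\<lambda>i xs. xs ! i) [0..<k])))"
    using assms(3) by (intro total_rec_comp) auto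
  then show ?thesis
  proof (rule total_rec_cong)
    fix xs :: "nat list" assume "length xs = k"
    then have "map (\<lambda>g. g xs) (map (\<lambda>i xs. xs ! i) [0..<k]) = xs"
      by (auto intro: nth_equalityI)
    then show "rec_nat (f xs) (\<lambda>n y. g (n # y # xs)) (b xs) =
      ?h (map (\<lambda>g. g xs) (b # map (\<lambda>i xs. xs ! i) [0..<k]))"
      by simp
  qed
qed

section \<open>Sums, products, powers of two and pairing\<close>

lemma total_rec_add [intro]:
  assumes "total_rec k f" "total_rec k g"
  shows "total_rec k (\<lambda>xs. f xs + g xs)"
proof -
  have "total_rec k (\<lambda>xs. rec_nat (g xs) (\<lambda>n y. Suc ((n # y # xs) ! 1)) (f xs))"
    using assms by (intro total_rec_rec_nat[where g = "\<lambda>ys. Suc (ys ! 1)"]) auto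
  moreover have "rec_nat b (\<lambda>n y. Suc y) a = a + b" for a b :: nat
    by (induction a) auto
  ultimately show ?thesis by simp
qed

lemma total_rec_sum:
  assumes "total_rec (Suc k) (\<lambda>ys. F (ys ! 0) (tl ys))" "total_rec k b"
  shows "total_rec k (\<lambda>xs. \<Sum>i<b xs. F i xs)"
proof -
  let ?G = "\<lambda>ys. ys ! 1 + F (ys ! 0) (tl (tl ys))"
  \<comment> \<open>These projections drop the second entry, the partial sum, which \<open>F\<close>
    does not see.\<close>
  let ?gs = "(\<lambda>ys. ys ! 0) # map (\<lambda>i ys. ys ! Suc (Suc i)) [0..<k]"
  have "total_rec (Suc (Suc k)) (\<lambda>ys. F (map (\<lambda>g. g ys) ?gs ! 0) (tl (map (\<lambda>g. g ys) ?gs)))"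
    using assms(1) by (intro total_rec_comp[of ?gs "\<lambda>ys. F (ys ! 0) (tl ys)"]) auto
  then have "total_rec (Suc (Suc k)) (\<lambda>ys. F (ys ! 0) (tl (tl ys)))"
  proof (rule total_rec_cong)
    fix ys :: "nat list" assume "length ys = Suc (Suc k)"
    then have "tl (map (\<lambda>g. g ys) ?gs) = tl (tl ys)"
      by (auto intro!: nth_equalityI simp: nth_tl)
    then show "F (ys ! 0) (tl (tl ys)) = F (map (\<lambda>g. g ys) ?gs ! 0) (tl (map (\<lambda>g. g ys) ?gs))"
      by simp
  qed
  then have "total_rec k (\<lambda>xs. rec_nat 0 (\<lambda>n y. ?G (n # y # xs)) (b xs))"
    using assms(2) by (intro total_rec_rec_nat[where g = ?G]) auto
  moreover have "rec_nat 0 (\<lambda>n y. ?G (n # y # xs)) m = (\<Sum>i<m. F i xs)" for m xs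
    by (induction m) auto
  ultimately show ?thesis by simp
qed

lemma total_rec_mult [intro]:
  assumes "total_rec k f" "total_rec k g"
  shows "total_rec k (\<lambda>xs. f xs * g xs)"
  using total_rec_sum[of k "\<lambda>_. g" f] assms by (simp add: total_rec_tl)

lemma total_rec_power2 [intro]:
  assumes "total_rec k f"
  shows "total_rec k (\<lambda>xs. 2 ^ f xs)"
proof -
  have "total_rec k (\<lambda>xs. rec_nat 1 (\<lambda>n y. (n # y # xs) ! 1 + (n # y # xs) ! 1) (f xs))"
    using assms by (intro total_rec_rec_nat[where g = "\<lambda>ys. ys ! 1 + ys ! 1"]) auto
  moreover have "rec_nat 1 (\<lambda>n y. y + y) a = (2 :: nat) ^ a" for a :: nat
    by (induction a) auto
  ultimately show ?thesis by simp
qed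

text \<open>The code of \<open>(m, n)\<close> is \<open>triangle (m + n) + m\<close>, and a
  triangular number is a bounded sum, so no division has to be computed.\<close>

lemma total_rec_prod_encode [intro]:
  assumes "total_rec k f" "total_rec k g"
  shows "total_rec k (\<lambda>xs. prod_encode (f xs, g xs))"
proof -
  have "total_rec k (\<lambda>xs. (\<Sum>i<f xs + g xs. Suc i) + f xs)"
    using assms by (intro total_rec_add total_rec_sum[where F = "\<lambda>i _. Suc i"]) auto
  moreover have "(\<Sum>i<n. Suc i) = triangle n" for n
    by (induction n) auto
  ultimately show ?thesis by (simp add: prod_encode_def)
qed


section \<open>The codes of the templates of a machine with input\<close>

text \<open>The code of the transitions of state \<open>Suc v\<close>, when it is the control state of an
  input-loading line. The number of actions is \<open>k + 2\<close>.\<close>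

definition line_code :: "nat \<Rightarrow> nat \<Rightarrow> nat" where
  "line_code k v = 2 ^ prod_encode (Suc v, prod_encode (0, Suc v)) +
     2 ^ prod_encode (Suc v, prod_encode (2, v)) +
     (\<Sum>a<Suc k. 2 ^ prod_encode (Suc v, prod_encode (2 * a + 4, 0)))"

text \<open>\<open>v\<close> is the control state of line \<open>t\<close>, \<open>k + 2\<close> the
  number of actions, \<open>A\<close> their bit mask and \<open>D\<close> the bit mask of the
  transitions present without loading lines, the start transition excepted. The number
  \<open>n\<close> of loading lines affects the number of states, the target of the start transition
  and the final sum.\<close>

definition input_code :: "nat \<Rightarrow> nat \<Rightarrow> nat \<Rightarrow> nat \<Rightarrow> nat \<Rightarrow> nat" where
  "input_code v k A D n = prod_encode (Suc (v + n), prod_encode (2, prod_encode (A,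
     D + 2 ^ prod_encode (2, prod_encode (2 * k + 1, v + n)) + (\<Sum>i<n. line_code k (v + i)))))"

lemma total_rec_line_code:
  assumes "total_rec k f" "total_rec k g"
  shows "total_rec k (\<lambda>xs. line_code (f xs) (g xs))"
  unfolding line_code_def
  by (intro total_rec_sum[where F = "\<lambda>a xs. 2 ^ prod_encode (Suc (g xs), prod_encode (2 * a + 4, 0))"]
      total_rec_add total_rec_power2 total_rec_prod_encode total_rec_mult total_rec_Suc
      total_rec_const total_rec_nth total_rec_tl assms zero_less_Suc)

lemma total_rec_input_code:
  assumes "total_rec k v" "total_rec k l" "total_rec k A" "total_rec k D" "total_rec k n"
  shows "total_rec k (\<lambda>xs. input_code (v xs) (l xs) (A xs) (D xs) (n xs))"
  unfolding input_code_def
  by (intro total_rec_sum[where F = "\<lambda>i xs. line_code (l xs) (v xs + i)"] total_rec_line_code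
      total_rec_add total_rec_power2 total_rec_prod_encode total_rec_mult total_rec_Suc
      total_rec_const total_rec_nth total_rec_tl assms zero_less_Suc)

section \<open>Bit masks of transition sets\<close>

definition weight :: "(nat \<times> label \<times> nat) set \<Rightarrow> nat" where
  "weight S = (\<Sum>x\<in>S. 2 ^ transition_code x)"

text \<open>A bit mask is a sum of powers of two, and distinct transitions have distinct codes.
  Hence the masks of disjoint sets of transitions can be added.\<close>

lemma set_encode_transition_code: "set_encode (transition_code ` S) = weight S"
  unfolding set_encode_def weight_def
  by (subst sum.reindex) (auto intro: inj_on_subset[OF inj_transition_code])

lemma weight_Un: "finite S \<Longrightarrow> finite T \<Longrightarrow> S \<inter> T = {} \<Longrightarrow> weight (S \<union> T) = weight S + weight T"
  unfolding weight_def by (rule sum.union_disjoint)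

lemma line_moves_source: "(i, l, j) \<in> line_moves R p I \<Longrightarrow> i = 4 + R + p"
  by (cases "(R, p, I)" rule: line_moves.cases) auto

definition line_receptions :: "nat \<Rightarrow> (nat \<Rightarrow> instr) \<Rightarrow> nat \<Rightarrow> (nat \<times> label \<times> nat) set" where
  "line_receptions R prog q = (\<lambda>a. (q, Receive a, receive R prog a q)) ` {..<3 * R + 2}"

lemma moves_Suc: "moves R prog (Suc t) = moves R prog t \<union> line_moves R (Suc t) (prog (Suc t))"
  unfolding moves_def atMost_Suc by auto

lemma receptions_Suc:
  "receptions R prog (Suc t) = receptions R prog t \<union> line_receptions R prog (5 + R + t)"
  by (auto simp: receptions_def line_receptions_def image_iff less_Suc_eq)

lemma weight_line:
  assumes "prog (Suc t) = Do (Inc 0) t"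
  shows "weight (line_moves R (Suc t) (prog (Suc t)) \<union> line_receptions R prog (5 + R + t)) =
    line_code (3 * R) (4 + R + t)"
proof -
  let ?q = "5 + R + t"
  have "weight (line_receptions R prog ?q) =
      (\<Sum>a<3 * R + 2. 2 ^ transition_code (?q, Receive a, receive R prog a ?q))"
    unfolding weight_def line_receptions_def by (subst sum.reindex) (auto simp: inj_on_def)
  \<comment> \<open>Action 0 is the increment of register 0, the only one that a loading line
    accepts; all others lead to the trap, which is state 0.\<close>
  also have "\<dots> = 2 ^ transition_code (?q, Receive 0, receive R prog 0 ?q) +
      (\<Sum>a<Suc (3 * R). 2 ^ transition_code (?q, Receive (Suc a), receive R prog (Suc a) ?q))"
    by (simp add: sum.lessThan_Suc_shift del: sum.lessThan_Suc)
  finally have "weight (line_receptions R prog ?q) =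
      2 ^ transition_code (?q, Receive 0, 4 + R + t) +
      (\<Sum>a<Suc (3 * R). 2 ^ transition_code (?q, Receive (Suc a), 0))"
    using assms by (simp add: receive_def)
  moreover have "weight (line_moves R (Suc t) (prog (Suc t)) \<union> line_receptions R prog ?q) =
      weight {(?q, Tau, ?q)} + weight (line_receptions R prog ?q)"
    using assms by (subst weight_Un) (auto simp: line_receptions_def add.assoc)
  moreover have "transition_code (?q, Tau, ?q) = prod_encode (?q, prod_encode (0, ?q))"
    "transition_code (?q, Receive 0, 4 + R + t) = prod_encode (?q, prod_encode (2, 4 + R + t))"
    "transition_code (?q, Receive (Suc a), 0) = prod_encode (?q, prod_encode (2 * a + 4, 0))" for a
    by (simp_all add: transition_code_def)
  moreover have "Suc (4 + R + t) = ?q" by simp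
  moreover have "weight {x} = 2 ^ transition_code x" for x by (simp add: weight_def)
  ultimately show ?thesis by (simp only: line_code_def add.assoc)
qed

text \<open>A loading line contributes exactly the transitions that leave its own new state. They
  are disjoint from the earlier ones, so the bit mask grows by one summand per line, while registers
  and actions stay the same.\<close>

lemma template_code_machine_template:
  assumes valid: "\<And>p. p \<le> t \<Longrightarrow> valid_instr R t (prog p)" and "R > 0"
    and input: "\<And>p. p > t \<Longrightarrow> prog p = Do (Inc 0) (p - 1)"
  shows "counter_machine R (t + n) prog"
    and "template_code (machine_template R prog (t + n)) = input_code (4 + R + t) (3 * R)
      (set_encode {..<3 * R + 2}) (weight (moves R prog t \<union> receptions R prog t)) n"
proof -
  have machine: "counter_machine R (t + n) prog" for n
  proof
    fix p assume p: "p \<le> t + n"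
    show "valid_instr R (t + n) (prog p)"
    proof (cases "p \<le> t")
      case True
      then show ?thesis using valid[OF True] by (cases "prog p") auto
    next
      case False
      then show ?thesis using input[of p] p \<open>R > 0\<close> by simp
    qed
  qed
  then show "counter_machine R (t + n) prog" .
  let ?base = "\<lambda>t. moves R prog t \<union> receptions R prog t"
  have finite: "finite (?base (t + n))" for n
  proof (rule finite_subset)
    show "?base (t + n) \<subseteq> delta (machine_template R prog (t + n))"
      by (auto simp: machine_template_def)
    show "finite (delta (machine_template R prog (t + n)))"
      using machine by (intro finite_delta counter_machine.broadcast_template_machine)
  qed
  have source: "i < 5 + R + t" if "(i, l, j) \<in> ?base t" for i l j t
    using that by (auto simp: moves_def receptions_def dest: line_moves_source)
  have weight_base: "weight (?base (t + n)) =
      weight (?base t) + (\<Sum>i<n. line_code (3 * R) (4 + R + t + i))" for n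
  proof (induction n)
    case (Suc n)
    let ?new = "line_moves R (Suc (t + n)) (prog (Suc (t + n))) \<union> line_receptions R prog (5 + R + (t + n))"
    have split: "?base (t + Suc n) = ?base (t + n) \<union> ?new"
      by (auto simp: moves_Suc receptions_Suc)
    have "finite (?base (t + n) \<union> ?new)"
      using finite[of "Suc n"] by (simp only: split)
    moreover have "?base (t + n) \<inter> ?new = {}"
    proof -
      have "i = 5 + R + (t + n)" if "(i, l, j) \<in> ?new" for i l j
        using that by (auto simp: line_receptions_def dest: line_moves_source)
      then show ?thesis using source[of _ _ _ "t + n"] by fastforce
    qed
    ultimately have "weight (?base (t + Suc n)) = weight (?base (t + n)) + weight ?new"
      unfolding split by (intro weight_Un) (simp_all only: finite_Un)
    also have "weight ?new = line_code (3 * R) (4 + R + (t + n))"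
      using input[of "Suc (t + n)"] by (intro weight_line) simp
    finally show ?case using Suc.IH by (simp add: add.assoc)
  qed simp
  have "(2, Send (3 * R), j) \<notin> ?base (t + n)" for j
    by (auto simp: moves_def receptions_def dest: line_moves_source)
  then have "weight (delta (machine_template R prog (t + n))) =
      2 ^ transition_code (2, Send (3 * R), 4 + R + t + n) + weight (?base (t + n))"
    using finite[of n] by (simp add: machine_template_def weight_def add.assoc)
  then have "weight (delta (machine_template R prog (t + n))) = weight (?base t) +
      2 ^ prod_encode (2, prod_encode (2 * (3 * R) + 1, 4 + R + t + n)) +
      (\<Sum>i<n. line_code (3 * R) (4 + R + t + i))"
    using weight_base[of n] by (simp add: transition_code_def)
  then show "template_code (machine_template R prog (t + n)) = input_code (4 + R + t) (3 * R)
      (set_encode {..<3 * R + 2}) (weight (?base t)) n"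
    by (simp add: template_code_def set_encode_transition_code input_code_def add.assoc)
qed


section \<open>Undecidability\<close>

text \<open>The number that represents a program as an input: with \<open>n\<close> as a fifth
  number, its four components determine the code of the template with \<open>n\<close> loading
  lines.\<close>

definition pack :: "nat \<Rightarrow> nat \<Rightarrow> nat \<Rightarrow> nat \<Rightarrow> nat" where
  "pack v k A D = prod_encode (v, prod_encode (k, prod_encode (A, D)))"

text \<open>Nondeterminism replaces the inversion of \<open>pack\<close>: the components are guessed and then
  verified.\<close>

lemma ex_unpacking_program:
  assumes "total_rec 4 S"
  shows "\<exists>c. \<forall>v k A D. (\<exists>s'. sem c ((\<lambda>_. 0)(0 := pack v k A D)) s') \<longleftrightarrow>
    rec_eval f [S [v, k, A, D]] 0"
proof -
  have "total_rec 4 (\<lambda>xs. pack (xs ! 0) (xs ! 1) (xs ! 2) (xs ! 3))"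
    unfolding pack_def by (intro total_rec_prod_encode total_rec_nth) auto
  then obtain e where e: "\<And>xs. length xs = 4 \<Longrightarrow>
      rec_eval e xs (pack (xs ! 0) (xs ! 1) (xs ! 2) (xs ! 3))"
    by (auto simp: total_rec_def)
  obtain r where r: "\<And>xs. length xs = 4 \<Longrightarrow> rec_eval r xs (S xs)"
    using assms by (auto simp: total_rec_def)
  have e_iff: "rec_eval e [v, k, A, D] z \<longleftrightarrow> z = pack v k A D" for v k A D z
    using e[of "[v, k, A, D]"] by (auto dest: rec_eval_det)
  have r_iff: "rec_eval (Comp f [r]) [v, k, A, D] z \<longleftrightarrow> rec_eval f [S [v, k, A, D]] z" for v k A D z
    using r[of "[v, k, A, D]"] by (auto simp: rec_eval_Comp_iff list_all2_Cons1 dest: rec_eval_det)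
  obtain c where c: "computes e [1, 2, 3, 4] 5 6 c"
    using ex_computes[of "[1, 2, 3, 4]" 6 5 e] by auto
  obtain d where d: "computes (Comp f [r]) [1, 2, 3, 4] 5 6 d"
    using ex_computes[of "[1, 2, 3, 4]" 6 5 "Comp f [r]"] by auto
  \<comment> \<open>Register 0 holds the input, 1 to 4 the guessed components and 5 the computed
    value; scratch registers start at 6.\<close>
  define s where "s = (\<lambda>x v k A D z. ((\<lambda>_. 0) :: store)(0 := x, 1 := v, 2 := k, 3 := A, 4 := D, 5 := z))"
  let ?guess = "guess 1 ;; guess 2 ;; guess 3 ;; guess 4"
  have guess: "sem ?guess ((\<lambda>_. 0)(0 := x)) u \<longleftrightarrow> (\<exists>v k A D. u = s x v k A D 0)" for x u
  proof -
    have "(\<exists>u. (\<exists>v. u = g v) \<and> P u) \<longleftrightarrow> (\<exists>v. P (g v))" for g :: "nat \<Rightarrow> store" and P by auto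
    then show ?thesis by (simp add: s_def fun_upd_idem)
  qed
  have run_c: "sem c (s x v k A D 0) u \<longleftrightarrow> u = s x v k A D (pack v k A D)" for x v k A D u
    using sem_computes[OF c, of "s x v k A D 0" u] by (simp add: s_def e_iff)
  \<comment> \<open>Wrong guesses end here, and register 5 is reset so that it can receive the value
    of \<open>f\<close>.\<close>
  have cancel: "sem (cancel 0 5) (s x v k A D z) u \<longleftrightarrow> x = z \<and> u = s 0 v k A D 0"
    for x v k A D z u
    by (auto simp: s_def fun_upd_twist)
  have run_d: "sem d (s 0 v k A D 0) u \<longleftrightarrow> (\<exists>z. rec_eval f [S [v, k, A, D]] z \<and> u = s 0 v k A D z)"
    for v k A D u
    using sem_computes[OF d, of "s 0 v k A D 0" u] by (simp add: s_def r_iff)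
  have test: "sem (Op (Test 5)) (s 0 v k A D z) u \<longleftrightarrow> z = 0 \<and> u = s 0 v k A D z" for v k A D z u
    by (auto simp: s_def)
  \<comment> \<open>The zero test lets the program finish only when \<open>f\<close> returns 0; any
    other value leaves it stuck.\<close>
  have accept: "sem (d ;; Op (Test 5)) (s 0 v k A D 0) u \<longleftrightarrow>
      rec_eval f [S [v, k, A, D]] 0 \<and> u = s 0 v k A D 0" for v k A D u
    unfolding sem_Seq[of d] run_d by (auto simp: test simp del: sem_Op)
  have "sem (cancel 0 5 ;; d ;; Op (Test 5)) (s x v k A D z) u \<longleftrightarrow>
      x = z \<and> sem (d ;; Op (Test 5)) (s 0 v k A D 0) u" for x v k A D z u
    unfolding sem_Seq[of "cancel 0 5"] cancel by blast
  moreover have "sem (c ;; cancel 0 5 ;; d ;; Op (Test 5)) (s x v k A D 0) u \<longleftrightarrow>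
      sem (cancel 0 5 ;; d ;; Op (Test 5)) (s x v k A D (pack v k A D)) u" for x v k A D u
    unfolding sem_Seq[of c] run_c by blast
  moreover have "sem (?guess ;; c ;; cancel 0 5 ;; d ;; Op (Test 5)) ((\<lambda>_. 0)(0 := x)) u \<longleftrightarrow>
      (\<exists>v k A D. sem (c ;; cancel 0 5 ;; d ;; Op (Test 5)) (s x v k A D 0) u)" for x u
    unfolding sem_Seq[of ?guess] guess by blast
  ultimately have "sem (?guess ;; c ;; cancel 0 5 ;; d ;; Op (Test 5)) ((\<lambda>_. 0)(0 := x)) u \<longleftrightarrow>
      (\<exists>v k A D. x = pack v k A D \<and> rec_eval f [S [v, k, A, D]] 0 \<and> u = s 0 v k A D 0)" for x u
    by (simp only: accept)
  moreover have "pack v k A D = pack v' k' A' D' \<longleftrightarrow> v = v' \<and> k = k' \<and> A = A' \<and> D = D'"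
    for v k A D v' k' A' D' by (simp add: pack_def)
  ultimately have "(\<exists>u. sem (?guess ;; c ;; cancel 0 5 ;; d ;; Op (Test 5))
      ((\<lambda>_. 0)(0 := pack v k A D)) u) \<longleftrightarrow> rec_eval f [S [v, k, A, D]] 0" for v k A D
    by (simp only:) blast
  then show ?thesis by blast
qed

theorem theorem5:
  "\<not> decidable_via template_code {B. broadcast_template B} has_deadlocked_run"
proof
  assume "decidable_via template_code {B. broadcast_template B} has_deadlocked_run"
  then obtain f where f: "\<And>B. broadcast_template B \<Longrightarrow>
      rec_eval f [template_code B] (if has_deadlocked_run B then 1 else 0)"
    by (auto simp: decidable_via_def)
  \<comment> \<open>The diagonal: the number to be loaded is the packed code of the program
    itself.\<close>
  let ?S = "\<lambda>xs. input_code (xs ! 0) (xs ! 1) (xs ! 2) (xs ! 3)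
    (pack (xs ! 0) (xs ! 1) (xs ! 2) (xs ! 3))"
  have "total_rec 4 ?S"
    unfolding pack_def by (intro total_rec_input_code total_rec_prod_encode total_rec_nth) auto
  from ex_unpacking_program[OF this] obtain c where c:
    "\<forall>v k A D. (\<exists>s'. sem c ((\<lambda>_. 0)(0 := pack v k A D)) s') \<longleftrightarrow> rec_eval f [?S [v, k, A, D]] 0" ..
  obtain R t prog where prog: "0 < R" "\<And>p. p \<le> t \<Longrightarrow> valid_instr R t (prog p)"
      "\<And>p. p > t \<Longrightarrow> prog p = Do (Inc 0) (p - 1)"
    and halts: "\<And>s. halts prog t s \<longleftrightarrow> (\<exists>s'. sem c s s')"
    using ex_program[of c] by auto
  let ?v = "4 + R + t" and ?k = "3 * R" and ?A = "set_encode {..<3 * R + 2}"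
    and ?D = "weight (moves R prog t \<union> receptions R prog t)"
  \<comment> \<open>The number of loading lines equals the code of the very program that they
    feed.\<close>
  define n where "n = pack ?v ?k ?A ?D"
  let ?B = "machine_template R prog (t + n)"
  have machine: "counter_machine R (t + n) prog"
    and code: "template_code ?B = input_code ?v ?k ?A ?D n"
    by (rule template_code_machine_template; use prog in blast)+
  have "has_deadlocked_run ?B \<longleftrightarrow> halts prog (t + n) (\<lambda>_. 0)"
    using machine by (rule counter_machine.has_deadlocked_run_machine_iff)
  also have "\<dots> \<longleftrightarrow> halts prog t ((\<lambda>_. 0)(0 := n))"
    using halts_input[OF prog(3)] by simp
  also have "\<dots> \<longleftrightarrow> rec_eval f [?S [?v, ?k, ?A, ?D]] 0"
    unfolding halts n_def by (rule c[rule_format])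
  also have "?S [?v, ?k, ?A, ?D] = template_code ?B"
    unfolding code by (simp add: n_def)
  finally have "has_deadlocked_run ?B \<longleftrightarrow> rec_eval f [template_code ?B] 0" .
  \<comment> \<open>If \<open>?B\<close> has a deadlocked run, \<open>f\<close> returns both 0 and 1
    on its code; if not, \<open>f\<close> returns 0, which would give such a run.\<close>
  moreover have "rec_eval f [template_code ?B] (if has_deadlocked_run ?B then 1 else 0)"
    using machine by (intro f counter_machine.broadcast_template_machine)
  ultimately show False
    using rec_eval_det by (metis zero_neq_one)
qed

end
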